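(* There exists a Tychonoff space $Z$ that is zero-dimensional, is an $F$-space, is not strongly zero-dimensional, and whose Čech–Stone remainder $\beta Z\setminus Z$ is an indecomposable continuum.
   Context: A topological space is zero-dimensional if it is a $T_1$-space and its clopen subsets form a base for its topology. A Tychonoff space $X$ is strongly zero-dimensional if its Čech–Stone compactification $\beta X$ is zero-dimensional. A Tychonoff space $X$ is an $F$-space if for every continuous $f:X\to\mathbb{R}$ there is a continuous $k:X\to\mathbb{R}$ such that $f=k\cdot|f|$. A continuum is a connected compact Hausdorff space (not necessarily metrizable); it is indecomposable if it is not the union of two proper subcontinua. The existence is asserted in $\mathsf{ZFC}$, with no additional set-theoretic assumptions. *)

theory Defs
  imports "HOL-Analysis.Analysis"
begin

definition tychonoff_space :: "'a topology \<Rightarrow> bool" where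
  "tychonoff_space X \<longleftrightarrow> completely_regular_space X \<and> Hausdorff_space X"

definition zero_dimensional :: "'a topology \<Rightarrow> bool" where
  "zero_dimensional X \<longleftrightarrow> t1_space X \<and>
     openin X = arbitrary union_of (\<lambda>U. openin X U \<and> closedin X U)"

(* The Cech-Stone compactification is the closure of the image of X under the evaluation map
   into the Tychonoff cube indexed by C(X,[0,1]).  Extensionality makes distinct indices
   distinct as functions on the space. *)

definition unit_functions :: "'a topology \<Rightarrow> ('a \<Rightarrow> real) set" where
  "unit_functions X =
     {f \<in> extensional (topspace X). continuous_map X (top_of_set {0..1}) f}"

definition unit_cube :: "'a topology \<Rightarrow> (('a \<Rightarrow> real) \<Rightarrow> real) topology" where
  "unit_cube X = product_topology (\<lambda>_. top_of_set {0..1}) (unit_functions X)"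

definition evaluation :: "'a topology \<Rightarrow> 'a \<Rightarrow> ('a \<Rightarrow> real) \<Rightarrow> real" where
  "evaluation X x = (\<lambda>f \<in> unit_functions X. f x)"

definition Cech_Stone :: "'a topology \<Rightarrow> (('a \<Rightarrow> real) \<Rightarrow> real) topology" where
  "Cech_Stone X =
     subtopology (unit_cube X) (unit_cube X closure_of (evaluation X ` topspace X))"

lemma topspace_Cech_Stone:
  "topspace (Cech_Stone X) = unit_cube X closure_of (evaluation X ` topspace X)"
  using closure_of_subset_topspace[of "unit_cube X"]
  by (auto simp: Cech_Stone_def)

lemma compact_space_Cech_Stone: "compact_space (Cech_Stone X)"
  unfolding Cech_Stone_def unit_cube_def
  by (intro closedin_compact_space closed_compactin closedin_closure_of compact_space_subtopology)
    (auto simp: compact_space_product_topology compact_space_subtopology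
      intro!: closedin_compact_space)

lemma Hausdorff_space_Cech_Stone: "Hausdorff_space (Cech_Stone X)"
  by (simp add: Cech_Stone_def unit_cube_def Hausdorff_space_subtopology
      Hausdorff_space_product_topology)

lemma evaluation_image_subset: "evaluation X ` topspace X \<subseteq> topspace (Cech_Stone X)"
proof -
  have "evaluation X x \<in> topspace (unit_cube X)" if "x \<in> topspace X" for x
    using that continuous_map_image_subset_topspace
    by (fastforce simp: evaluation_def unit_cube_def unit_functions_def)
  then show ?thesis
    unfolding topspace_Cech_Stone by (intro closure_of_subset) blast
qed

lemma evaluation_dense:
  "Cech_Stone X closure_of (evaluation X ` topspace X) = topspace (Cech_Stone X)"
  using evaluation_image_subset[of X] unfolding topspace_Cech_Stone
  by (simp add: Cech_Stone_def closure_of_subtopology_open)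

lemma unit_functions_eq_mspace:
  "unit_functions X =
     mspace (submetric (cfunspace X euclidean_metric) {f. f \<in> topspace X \<rightarrow> {0..1}})"
proof -
  have "bounded (f ` topspace X)" if "f \<in> topspace X \<rightarrow> {0..1}" for f :: "'a \<Rightarrow> real"
    by (rule bounded_subset[OF bounded_closed_interval[of 0 1]]) (use that in auto)
  then show ?thesis
    by (auto simp: unit_functions_def continuous_map_in_subtopology Pi_iff)
qed

lemma embedding_map_evaluation:
  assumes "tychonoff_space X"
  shows "embedding_map X (Cech_Stone X) (evaluation X)"
proof -
  have "embedding_map X (unit_cube X) (evaluation X)"
    using completely_regular_space_cube_embedding_explicit[of X] assms
    by (simp only: tychonoff_space_def unit_cube_def evaluation_def[abs_def]
        unit_functions_eq_mspace)
  then show ?thesis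
    using evaluation_image_subset[of X]
    by (simp add: topspace_Cech_Stone Cech_Stone_def embedding_map_def subtopology_subtopology
        inf_absorb2)
qed

lemma Cech_Stone_extension:
  assumes "continuous_map X (top_of_set {0..1}) f"
  obtains g where "continuous_map (Cech_Stone X) (top_of_set {0..1::real}) g"
    and "\<And>x. x \<in> topspace X \<Longrightarrow> g (evaluation X x) = f x"
proof
  let ?f = "restrict f (topspace X)"
  have f: "?f \<in> unit_functions X"
    using assms by (auto simp: unit_functions_def intro: continuous_map_eq)
  show "continuous_map (Cech_Stone X) (top_of_set {0..1}) (\<lambda>p. p ?f)"
    unfolding Cech_Stone_def unit_cube_def
    by (rule continuous_map_from_subtopology[OF continuous_map_product_projection[OF f]])
  show "evaluation X x ?f = f x" if "x \<in> topspace X" for x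
    using that f by (simp add: evaluation_def)
qed

definition Cech_Stone_remainder :: "'a topology \<Rightarrow> (('a \<Rightarrow> real) \<Rightarrow> real) topology" where
  "Cech_Stone_remainder X =
     subtopology (Cech_Stone X) (topspace (Cech_Stone X) - evaluation X ` topspace X)"

definition strongly_zero_dimensional :: "'a topology \<Rightarrow> bool" where
  "strongly_zero_dimensional X \<longleftrightarrow> tychonoff_space X \<and> zero_dimensional (Cech_Stone X)"

definition F_space :: "'a topology \<Rightarrow> bool" where
  "F_space X \<longleftrightarrow> tychonoff_space X \<and>
     (\<forall>f. continuous_map X euclideanreal f \<longrightarrow>
        (\<exists>k. continuous_map X euclideanreal k \<and>
             (\<forall>x \<in> topspace X. f x = k x * \<bar>f x\<bar>)))"

definition continuum :: "'a topology \<Rightarrow> bool" where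
  "continuum X \<longleftrightarrow> connected_space X \<and> compact_space X \<and> Hausdorff_space X"

definition indecomposable_continuum :: "'a topology \<Rightarrow> bool" where
  "indecomposable_continuum X \<longleftrightarrow> continuum X \<and>
     \<not> (\<exists>A B. A \<subset> topspace X \<and> continuum (subtopology X A) \<and>
              B \<subset> topspace X \<and> continuum (subtopology X B) \<and>
              topspace X = A \<union> B)"

end

(* Let I be the real line with cocountable neighbourhoods of an added point, let J be the power set of the
   reals with neighbourhoods of an added point whose complement has size at most continuum, and put a copy
   of the compact zero-dimensional F-space omega* over each point of the plank (I+1) x (J+1) minus its
   corner.  On the fibres over the two edges, weaken the topology so that continuous functions are those
   induced by bounded sequences constant on the pairs {2n,2n+1}, respectively {2n-1,2n}.  The edge points
   are P-points of the base, so a continuous function is constant in the index direction near them, and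
   counting exceptional rows and columns shows that near the corner it is given by one bounded sequence g
   that is constant on both kinds of pairs modulo c_0, that is, g(n+1) - g(n) -> 0.  Hence the corner of
   the Cech-Stone compactification carries exactly the slowly oscillating sequences modulo c_0: it is the
   corona of the half-line, an indecomposable continuum.  Away from the corner a function is described
   by arbitrary bounded sequences, to which indicator or sign functions can be applied term by term; this
   yields clopen sets and, with a slowly oscillating sign sequence at the corner, the F-space property.  Z is the
   complement of the corner. *)

theory Submission
  imports Defs
begin

section \<open>Slowly oscillating sequences\<close>

text \<open>On omega itself, respecting both pairings would leave only the constants; the fibres are
  omega* because there sequences count modulo c_0, and only slow oscillation is forced. The factors
  must differ in size: the exceptional columns of continuum many rows still number at most the
  continuum, so by Cantor one column is good for all rows, and this column misbehaves at only
  countably many of the uncountably many rows. Exact constancy in the index direction is what makes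
  discontinuous operations legal: they act on a representing sequence, and only compatibility with
  the pairings and between neighbouring indices has to be checked. Near the corner this freedom is
  lost, and the new sequence must again be slow. Ends merged by a pairing cannot be separated on an
  edge fibre, so the plank is not Hausdorff. Hence \<open>Z\<close> is cut out of its Cech-Stone
  compactification; a bounded function on \<open>Z\<close> extends because its pullback to the plank
  does, so this is also the compactification of \<open>Z\<close>. A copy on a fixed type is used, as
  the theorem fixes the type of the points.\<close>

definition unit_seq :: "(nat \<Rightarrow> real) \<Rightarrow> bool" where
  "unit_seq g \<longleftrightarrow> (\<forall>n. g n \<in> {0..1})"

definition slow :: "(nat \<Rightarrow> real) \<Rightarrow> bool" where
  "slow g \<longleftrightarrow> (\<lambda>n. g (Suc n) - g n) \<longlonglongrightarrow> 0"

text \<open>Used to choose a gain that tends to infinity below a prescribed rate and still has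
  bounded steps.\<close>

lemma slow_growth_below:
  fixes r :: "nat \<Rightarrow> real"
  assumes pos: "\<And>n. r n > 0" and lim: "filterlim r at_top sequentially"
  obtains K where "\<And>n. 0 \<le> K n" "\<And>n. K n \<le> r n" "\<And>n. \<bar>K (Suc n) - K n\<bar> \<le> 1"
    "filterlim K at_top sequentially"
proof
  \<comment> \<open>The largest 1-Lipschitz minorant of \<open>r\<close>.\<close>
  define K where "K n = (INF m. r m + \<bar>real n - real m\<bar>)" for n
  have bdd: "bdd_below (range (\<lambda>m. r m + \<bar>real n - real m\<bar>))" for n
    using pos by (intro bdd_belowI2[of _ 0]) (simp add: add_nonneg_nonneg less_imp_le)
  show "0 \<le> K n" for n
    unfolding K_def using pos by (intro cINF_greatest) (auto simp: add_nonneg_nonneg less_imp_le)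
  show "K n \<le> r n" for n
    unfolding K_def using cINF_lower[OF bdd, of n n] by simp
  have *: "K n \<le> K n' + 1" if "\<bar>real n - real n'\<bar> \<le> 1" for n n'
  proof -
    have "K n - 1 \<le> r m + \<bar>real n' - real m\<bar>" for m
      using cINF_lower[OF bdd, of m n] that unfolding K_def by simp
    then have "K n - 1 \<le> K n'"
      unfolding K_def[of n'] by (intro cINF_greatest) auto
    then show ?thesis by simp
  qed
  show "\<bar>K (Suc n) - K n\<bar> \<le> 1" for n
    using *[of "Suc n" n] *[of n "Suc n"] by simp
  show "filterlim K at_top sequentially"
    unfolding filterlim_at_top
  proof
    fix M :: real
    obtain N where N: "\<And>m. m \<ge> N \<Longrightarrow> r m \<ge> M"
      using lim by (auto simp: filterlim_at_top eventually_sequentially)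
    \<comment> \<open>For \<open>m \<ge> N\<close> the value \<open>r m\<close> is already large;
      for \<open>m < N\<close> the distance from \<open>n\<close> to \<open>m\<close> exceeds
      \<open>\<bar>M\<bar>\<close>.\<close>
    have "K n \<ge> M" if n: "real n \<ge> real N + \<bar>M\<bar>" for n
      unfolding K_def
    proof (intro cINF_greatest)
      fix m
      show "M \<le> r m + \<bar>real n - real m\<bar>"
        using n N[of m] pos[of m] by (cases "m \<ge> N") auto
    qed auto
    moreover have "\<forall>\<^sub>F n in sequentially. real n \<ge> real N + \<bar>M\<bar>"
      using filterlim_real_sequentially unfolding filterlim_at_top by blast
    ultimately show "\<forall>\<^sub>F n in sequentially. M \<le> K n"
      by (auto elim: eventually_mono)
  qed
qed

definition clamp1 :: "real \<Rightarrow> real" where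
  "clamp1 x = max (-1) (min 1 x)"

lemma clamp1_lipschitz: "\<bar>clamp1 x - clamp1 y\<bar> \<le> \<bar>x - y\<bar>"
  by (auto simp: clamp1_def)

lemma clamp01_lipschitz: "\<bar>max 0 (min 1 x) - max 0 (min 1 y)\<bar> \<le> \<bar>x - y\<bar>" for x y :: real
  by auto

text \<open>Either \<open>x\<close> times the smaller factor is saturated, and both clamped values
  coincide, or \<open>\<bar>x\<bar>\<close> is below the reciprocal of that factor and the Lipschitz
  bound applies.\<close>

lemma clamp1_rescale:
  assumes "a \<ge> 1" "b \<ge> 1" "\<bar>a - b\<bar> \<le> 1"
  shows "\<bar>clamp1 (x * a) - clamp1 (x * b)\<bar> \<le> 1 / min a b"
proof -
  let ?m = "min a b"
  have m: "?m \<ge> 1" using assms by simp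
  consider "x * ?m \<ge> 1" | "x * ?m \<le> -1" | "\<bar>x * ?m\<bar> < 1" by linarith
  then show ?thesis
  proof cases
    case 1
    then have "x > 0" using m by (intro zero_less_mult_pos2[of x ?m]) linarith+
    then have "x * a \<ge> x * ?m" "x * b \<ge> x * ?m" by auto
    then show ?thesis using 1 m by (simp add: clamp1_def)
  next
    case 2
    then have "x < 0" using m mult_nonneg_nonneg[of x ?m] by linarith
    then have "x * a \<le> x * ?m" "x * b \<le> x * ?m" by auto
    then show ?thesis using 2 m by (simp add: clamp1_def)
  next
    case 3
    then have x: "\<bar>x\<bar> \<le> 1 / ?m"
      using m by (simp add: abs_mult pos_le_divide_eq)
    have "\<bar>clamp1 (x * a) - clamp1 (x * b)\<bar> \<le> \<bar>x\<bar> * \<bar>a - b\<bar>"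
      using clamp1_lipschitz[of "x*a" "x*b"] by (simp add: abs_mult flip: right_diff_distrib)
    also have "\<dots> \<le> \<bar>x\<bar> * 1" using assms by (intro mult_left_mono) auto
    finally show ?thesis using x by linarith
  qed
qed

text \<open>A sign of \<open>g\<close> softened to slope \<open>K n\<close>: the error is confined
  to \<open>\<bar>g n\<bar> \<le> 1 / K n\<close>, so \<open>K\<close> has to tend to infinity, but
  slowly enough that \<open>K n\<close> times the step of \<open>g\<close> tends to 0.\<close>

lemma slow_sign:
  assumes "slow g" "\<And>n. \<bar>g n\<bar> \<le> 1"
  obtains h where "slow h" "\<And>n. \<bar>h n\<bar> \<le> 1" "(\<lambda>n. g n - h n * \<bar>g n\<bar>) \<longlonglongrightarrow> 0"
proof -
  define d where "d n = \<bar>g (Suc n) - g n\<bar>" for n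
  have d: "d \<longlonglongrightarrow> 0" "\<And>n. d n \<ge> 0"
    using assms(1) tendsto_rabs_zero unfolding slow_def d_def by auto
  \<comment> \<open>The square root yields \<open>K n * d n \<le> sqrt (d n)\<close>; the second
    summand keeps \<open>s n\<close> positive where \<open>d n\<close> vanishes.\<close>
  define s where "s n = sqrt (d n) + inverse (real (Suc n))" for n
  have s0: "s n > 0" for n
    unfolding s_def using d(2)[of n] by (intro add_nonneg_pos) auto
  have s: "s \<longlonglongrightarrow> 0"
    unfolding s_def using tendsto_add[OF tendsto_real_sqrt[OF d(1)] LIMSEQ_inverse_real_of_nat]
    by simp
  have "filterlim (\<lambda>n. inverse (s n)) at_top sequentially"
    using s s0 by (intro filterlim_inverse_at_top) auto
  then obtain K where K: "\<And>n. 0 \<le> K n" "\<And>n. K n \<le> inverse (s n)"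
      "\<And>n. \<bar>K (Suc n) - K n\<bar> \<le> 1" "filterlim K at_top sequentially"
    using slow_growth_below[of "\<lambda>n. inverse (s n)"] s0 by (metis positive_imp_inverse_positive)
  define h where "h n = clamp1 (g n * K n)" for n
  have invK: "(\<lambda>n. inverse (K n)) \<longlonglongrightarrow> 0"
    by (rule tendsto_inverse_0_at_top[OF K(4)])
  have invK1: "(\<lambda>n. inverse (K n - 1)) \<longlonglongrightarrow> 0"
    by (rule tendsto_inverse_0_at_top, rule filterlim_tendsto_add_at_top[where c = "-1" and f = "\<lambda>_. -1" and g = K, simplified])
       (use K(4) in auto)
  have K2: "\<forall>\<^sub>F n in sequentially. K n \<ge> 2"
    using K(4) by (auto simp: filterlim_at_top)
  \<comment> \<open>Split the step: moving \<open>g\<close> at fixed gain costs at most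
    \<open>K n * d n\<close>, changing the gain at fixed \<open>g\<close> at most the reciprocal of
    the smaller gain, which is at least \<open>K n - 1\<close>.\<close>
  have step: "\<bar>h (Suc n) - h n\<bar> \<le> sqrt (d n) + inverse (K n - 1)" if "K n \<ge> 2" for n
  proof -
    have "K n * d n \<le> sqrt (d n)"
    proof (cases "d n = 0")
      case False
      then have dn: "d n > 0" using d(2)[of n] by simp
      have "K n \<le> inverse (s n)" by (rule K)
      also have "\<dots> \<le> inverse (sqrt (d n))"
        using dn by (intro le_imp_inverse_le) (auto simp: s_def)
      finally have "K n * d n \<le> inverse (sqrt (d n)) * d n"
        using dn by (intro mult_right_mono) auto
      also have "\<dots> = sqrt (d n)"
        using dn by (simp add: field_simps)
      finally show ?thesis .
    qed simp
    moreover have "\<bar>clamp1 (g (Suc n) * K n) - clamp1 (g n * K n)\<bar> \<le> K n * d n"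
      using clamp1_lipschitz[of "g (Suc n) * K n" "g n * K n"] K(1)[of n]
      by (simp add: d_def abs_mult mult.commute[of "K n"] flip: left_diff_distrib)
    moreover have "\<bar>clamp1 (g (Suc n) * K (Suc n)) - clamp1 (g (Suc n) * K n)\<bar> \<le> 1 / min (K (Suc n)) (K n)"
      using that K(3)[of n] by (intro clamp1_rescale) auto
    moreover have "1 / min (K (Suc n)) (K n) \<le> inverse (K n - 1)"
      using that K(3)[of n] unfolding inverse_eq_divide by (intro divide_left_mono) auto
    ultimately show ?thesis unfolding h_def by linarith
  qed
  show thesis
  proof
    have "(\<lambda>n. sqrt (d n) + inverse (K n - 1)) \<longlonglongrightarrow> 0"
      using tendsto_add[OF tendsto_real_sqrt[OF d(1)] invK1] by simp
    then show "slow h"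
      unfolding slow_def
      by (rule Lim_null_comparison[rotated]) (use K2 step in \<open>auto elim!: eventually_mono\<close>)
    show "\<bar>h n\<bar> \<le> 1" for n by (auto simp: h_def clamp1_def)
    show "(\<lambda>n. g n - h n * \<bar>g n\<bar>) \<longlonglongrightarrow> 0"
    proof (rule Lim_null_comparison)
      show "(\<lambda>n. 2 * inverse (K n)) \<longlonglongrightarrow> 0"
        using tendsto_mult_left[OF invK, of 2] by simp
      have "\<bar>g n - h n * \<bar>g n\<bar>\<bar> \<le> 2 * inverse (K n)" if "K n \<ge> 2" for n
      proof -
        consider "g n * K n \<ge> 1" | "g n * K n \<le> -1" | "\<bar>g n * K n\<bar> < 1" by linarith
        then show ?thesis
        proof cases
          case 1
          then have "g n > 0" using that by (intro zero_less_mult_pos2[of "g n" "K n"]) linarith+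
          then show ?thesis using 1 that by (simp add: h_def clamp1_def)
        next
          case 2
          then have "g n < 0" using that mult_nonneg_nonneg[of "g n" "K n"] by linarith
          then show ?thesis using 2 that by (simp add: h_def clamp1_def)
        next
          case 3
          then have x: "\<bar>g n\<bar> \<le> inverse (K n)"
            using that by (simp add: abs_mult field_simps)
          have "\<bar>h n\<bar> * \<bar>g n\<bar> \<le> 1 * \<bar>g n\<bar>"
            by (intro mult_right_mono) (auto simp: h_def clamp1_def)
          then have "\<bar>h n * \<bar>g n\<bar>\<bar> \<le> \<bar>g n\<bar>"
            by (simp only: abs_mult abs_abs mult_1)
          then show ?thesis using x abs_triangle_ineq4[of "g n" "h n * \<bar>g n\<bar>"]
            by linarith
        qed
      qed
      then show "\<forall>\<^sub>F n in sequentially. norm (g n - h n * \<bar>g n\<bar>) \<le> 2 * inverse (K n)"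
        unfolding real_norm_def by (rule eventually_mono[OF K2])
    qed
  qed
qed

text \<open>\<open>slow_sign\<close> transported to the unit interval, because functions into the
  unit interval are the ones that extend to compactifications; 1/2 plays the part of zero.\<close>

lemma slow_sign_unit:
  assumes "slow g" "unit_seq g"
  obtains h where "slow h" "unit_seq h"
    "(\<lambda>n. (2 * g n - 1) - (2 * h n - 1) * \<bar>2 * g n - 1\<bar>) \<longlonglongrightarrow> 0"
proof -
  have "slow (\<lambda>n. 2 * g n - 1)"
    using tendsto_mult_left[OF assms(1)[unfolded slow_def], of 2]
    by (simp add: slow_def algebra_simps)
  moreover have "\<bar>2 * g n - 1\<bar> \<le> 1" for n
    using assms(2) by (auto simp: unit_seq_def abs_le_iff)
  ultimately obtain h where h: "slow h" "\<And>n. \<bar>h n\<bar> \<le> 1"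
    "(\<lambda>n. (2 * g n - 1) - h n * \<bar>2 * g n - 1\<bar>) \<longlonglongrightarrow> 0"
    using slow_sign[of "\<lambda>n. 2 * g n - 1"] by blast
  show thesis
  proof
    show "slow (\<lambda>n. (h n + 1) / 2)"
      using tendsto_divide[OF h(1)[unfolded slow_def] tendsto_const[of 2]]
      unfolding slow_def by (simp add: diff_divide_distrib add_divide_distrib)
    show "unit_seq (\<lambda>n. (h n + 1) / 2)"
      unfolding unit_seq_def
    proof
      fix n show "(h n + 1) / 2 \<in> {0..1}" using h(2)[of n] by (simp add: abs_le_iff)
    qed
    show "(\<lambda>n. (2 * g n - 1) - (2 * ((h n + 1) / 2) - 1) * \<bar>2 * g n - 1\<bar>) \<longlonglongrightarrow> 0"
      using h(3) by (simp add: add_divide_distrib)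
  qed
qed

text \<open>The value of \<open>h\<close> flips between 0 and 1 in alternation, but only at places where \<open>g\<close> is large
  and \<open>h\<close> has been damped to 1/2.\<close>

lemma slow_flip:
  assumes g: "slow g" "unit_seq g"
    and M: "infinite M" "\<And>n. n \<in> M \<Longrightarrow> g n \<ge> 2/3"
    and N: "infinite N" "\<And>n. n \<in> N \<Longrightarrow> g n \<le> 1/3"
  obtains h where "slow h" "unit_seq h" "\<And>n. g n \<le> 1/3 \<Longrightarrow> h n = 0 \<or> h n = 1"
    "infinite {n\<in>N. h n = 0}" "infinite {n\<in>N. h n = 1}"
proof -
  \<comment> \<open>Between consecutive chosen points of \<open>M\<close> lies a point of
    \<open>N\<close>.\<close>
  have "\<exists>r. \<forall>i. r i \<in> M \<and> (\<exists>n\<in>N. r i < n \<and> n < r (Suc i))"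
  proof (rule dependent_nat_choice)
    show "\<exists>x. x \<in> M" using infinite_imp_nonempty[OF M(1)] by blast
    fix x :: nat and i :: nat
    obtain n where n: "n \<in> N" "x < n" using N(1) by (auto simp: infinite_nat_iff_unbounded)
    moreover obtain y where "y \<in> M" "n < y" using M(1) by (auto simp: infinite_nat_iff_unbounded)
    ultimately show "\<exists>y. y \<in> M \<and> (\<exists>n\<in>N. x < n \<and> n < y)" by blast
  qed
  then obtain r where r: "\<And>i. r i \<in> M" "\<And>i. \<exists>n\<in>N. r i < n \<and> n < r (Suc i)" by blast
  have "strict_mono r" by (rule strict_mono_Suc_iff[THEN iffD2]) (use r(2) less_trans in blast)
  then have rle: "r i \<le> r j \<longleftrightarrow> i \<le> j" and ri: "i \<le> r i" for i j
    by (auto simp: strict_mono_less_eq strict_mono_imp_increasing)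
  \<comment> \<open>The target value flips exactly when \<open>n\<close> passes some
    \<open>r i\<close>, so only at points of \<open>M\<close>.\<close>
  define c :: "nat \<Rightarrow> real" where "c n = of_bool (even (card {i. r i \<le> n}))" for n
  \<comment> \<open>A ramp of slope 3 in \<open>g\<close>: 0 up to 1/3 and 1 from 2/3 on, so that at
    points of \<open>M\<close> the target has weight 0.\<close>
  define s where "s n = max 0 (min 1 (3 * g n - 1))" for n
  define h where "h n = 1/2 + (c n - 1/2) * (1 - s n)" for n
  have c01: "c n = 0 \<or> c n = 1" for n by (simp add: c_def)
  have s01: "0 \<le> s n" "s n \<le> 1" for n by (auto simp: s_def)
  have hs: "\<bar>h n - 1/2\<bar> = (1 - s n) / 2" for n
    using c01[of n] s01[of n] by (auto simp: h_def abs_mult)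
  have const: "c (Suc n) = c n" if "Suc n \<notin> M" for n
  proof -
    have "{i. r i \<le> Suc n} = {i. r i \<le> n}" using that r(1) by (auto simp: le_Suc_eq) metis
    then show ?thesis by (simp add: c_def)
  qed
  have step: "\<bar>h (Suc n) - h n\<bar> \<le> 3 * \<bar>g (Suc n) - g n\<bar>" for n
  proof -
    have ds: "\<bar>s (Suc n) - s n\<bar> \<le> 3 * \<bar>g (Suc n) - g n\<bar>" 
    proof -
      have e: "3 * g (Suc n) - 1 - (3 * g n - 1) = 3 * (g (Suc n) - g n)" by simp
      show ?thesis
        using clamp01_lipschitz[of "3 * g (Suc n) - 1" "3 * g n - 1"]
        unfolding s_def e abs_mult abs_numeral .
    qed
    show ?thesis
    proof (cases "Suc n \<in> M")
      case True
      then have "s (Suc n) = 1" using M(2) by (force simp: s_def)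
      then have "h (Suc n) = 1/2" "s (Suc n) - s n = 1 - s n" using hs[of "Suc n"] by auto
      then have "\<bar>h (Suc n) - h n\<bar> = (1 - s n) / 2" "\<bar>s (Suc n) - s n\<bar> = 1 - s n"
        using hs[of n] s01[of n] by (simp_all only: abs_minus_commute[of "1/2"] abs_of_nonneg diff_ge_0_iff_ge)
      then show ?thesis using ds s01(2)[of n] by argo
    next
      case False
      have "h (Suc n) - h n = (c n - 1/2) * (s n - s (Suc n))"
        using const[OF False] by (simp add: h_def flip: right_diff_distrib)
      then have "\<bar>h (Suc n) - h n\<bar> = 1/2 * \<bar>s (Suc n) - s n\<bar>"
        using c01[of n] by (auto simp: abs_mult)
      then show ?thesis using ds abs_ge_zero[of "s (Suc n) - s n"] by argo
    qed
  qed
  have small: "h n = c n" if "g n \<le> 1/3" for n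
  proof -
    have "s n = 0" using that by (simp add: s_def)
    then show ?thesis by (simp add: h_def)
  qed
  \<comment> \<open>At a point strictly between \<open>r i\<close> and \<open>r (Suc i)\<close>
    exactly \<open>Suc i\<close> of the points \<open>r j\<close> have been passed; \<open>i\<close>
    even gives the value 0 and \<open>i\<close> odd the value 1.\<close>
  have inf: "\<exists>n\<in>N. m < n \<and> c n = of_bool (even (Suc i))" if "m \<le> i" for m i
  proof -
    obtain n where n: "n \<in> N" "r i < n" "n < r (Suc i)" using r(2) by blast
    have "r j \<le> n \<longleftrightarrow> j \<le> i" for j
      using n rle[of j i] rle[of "Suc i" j] by (auto simp: not_less_eq_eq)
    then have "{j. r j \<le> n} = {..i}" by auto
    then show ?thesis using n ri[of i] that by (intro bexI[of _ n]) (auto simp: c_def)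
  qed
  show thesis
  proof
    show "slow h" unfolding slow_def
    proof (rule Lim_null_comparison)
      show "(\<lambda>n. 3 * \<bar>g (Suc n) - g n\<bar>) \<longlonglongrightarrow> 0"
        using tendsto_mult_left[OF tendsto_rabs_zero[OF g(1)[unfolded slow_def]], of 3] by simp
    qed (use step in auto)
    show "unit_seq h" unfolding unit_seq_def
    proof
      fix n show "h n \<in> {0..1}" using abs_le_D1[OF eq_refl[OF hs[of n]]] abs_le_D2[OF eq_refl[OF hs[of n]]] s01[of n]
        unfolding atLeastAtMost_iff by argo
    qed
    show "h n = 0 \<or> h n = 1" if "g n \<le> 1/3" for n using small[OF that] c01 by simp
    show "infinite {n\<in>N. h n = 0}"
      unfolding infinite_nat_iff_unbounded
    proof
      fix m
      show "\<exists>n>m. n \<in> {n\<in>N. h n = 0}" using inf[of m "2*m"] small N(2) by force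
    qed
    show "infinite {n\<in>N. h n = 1}"
      unfolding infinite_nat_iff_unbounded
    proof
      fix m
      show "\<exists>n>m. n \<in> {n\<in>N. h n = 1}" using inf[of m "2*m+1"] small N(2) by force
    qed
  qed
qed

section \<open>Adjacent pairs of natural numbers\<close>

definition low_pair :: "nat \<Rightarrow> nat" where "low_pair n = n div 2"

definition high_pair :: "nat \<Rightarrow> nat" where "high_pair n = Suc n div 2"

text \<open>\<open>2 * low_pair n\<close> is \<open>n\<close> or \<open>n - 1\<close>, and
  \<open>2 * high_pair n\<close> is \<open>n\<close> or \<open>n + 1\<close>. So modulo c_0 a slow
  sequence is a function of either block number.\<close>

lemma slow_subseq:
  assumes "slow h"
  shows "(\<lambda>n. h n - h (2 * low_pair n)) \<longlonglongrightarrow> 0" "(\<lambda>n. h n - h (2 * high_pair n)) \<longlonglongrightarrow> 0"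
proof -
  have d: "(\<lambda>n. \<bar>h (Suc n) - h n\<bar>) \<longlonglongrightarrow> 0"
    using assms tendsto_rabs_zero by (auto simp: slow_def)
  then have d': "(\<lambda>n. \<bar>h (Suc (n - 1)) - h (n - 1)\<bar>) \<longlonglongrightarrow> 0"
    by (rule filterlim_compose) (rule filterlim_minus_const_nat_at_top)
  have "\<bar>h n - h (2 * low_pair n)\<bar> \<le> \<bar>h (Suc (n - 1)) - h (n - 1)\<bar>" for n
    by (cases "even n") (auto simp: low_pair_def elim!: oddE)
  then show "(\<lambda>n. h n - h (2 * low_pair n)) \<longlonglongrightarrow> 0"
    by (intro Lim_null_comparison[OF _ d']) auto
  have "\<bar>h n - h (2 * high_pair n)\<bar> \<le> \<bar>h (Suc n) - h n\<bar>" for n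
    by (cases "even n") (auto simp: high_pair_def elim!: oddE)
  then show "(\<lambda>n. h n - h (2 * high_pair n)) \<longlonglongrightarrow> 0"
    by (intro Lim_null_comparison[OF _ d]) auto
qed

text \<open>Two successive numbers are merged by \<open>low_pair\<close> if the first is even and by
  \<open>high_pair\<close> if it is odd; hence closeness to functions of both block numbers controls
  every step.\<close>

lemma slow_if_both_pairs:
  assumes "(\<lambda>n. g n - k (low_pair n)) \<longlonglongrightarrow> 0" "(\<lambda>n. g n - l (high_pair n)) \<longlonglongrightarrow> 0"
  shows "slow g"
proof -
  let ?a = "\<lambda>n. \<bar>g n - k (low_pair n)\<bar>" and ?b = "\<lambda>n. \<bar>g n - l (high_pair n)\<bar>"
  have "(\<lambda>n. (?a n + ?a (Suc n)) + (?b n + ?b (Suc n))) \<longlonglongrightarrow> (0 + 0) + (0 + 0)"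
    using assms by (intro tendsto_add LIMSEQ_Suc tendsto_rabs_zero)
  then have lim: "(\<lambda>n. (?a n + ?a (Suc n)) + (?b n + ?b (Suc n))) \<longlonglongrightarrow> 0"
    unfolding add_0_left .
  have bound: "\<bar>g (Suc n) - g n\<bar> \<le> (?a n + ?a (Suc n)) + (?b n + ?b (Suc n))" for n
  proof (cases "even n")
    case True
    then have "low_pair (Suc n) = low_pair n" by (auto simp: low_pair_def)
    then have "g (Suc n) - g n = (g (Suc n) - k (low_pair (Suc n))) - (g n - k (low_pair n))" by simp
    then have "\<bar>g (Suc n) - g n\<bar> \<le> ?a (Suc n) + ?a n"
      using abs_triangle_ineq4 by metis
    moreover have "0 \<le> ?b n" "0 \<le> ?b (Suc n)" by (rule abs_ge_zero)+
    ultimately show ?thesis by argo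
  next
    case False
    then have "high_pair (Suc n) = high_pair n" by (auto simp: high_pair_def elim!: oddE)
    then have "g (Suc n) - g n = (g (Suc n) - l (high_pair (Suc n))) - (g n - l (high_pair n))" by simp
    then have "\<bar>g (Suc n) - g n\<bar> \<le> ?b (Suc n) + ?b n"
      using abs_triangle_ineq4 by metis
    moreover have "0 \<le> ?a n" "0 \<le> ?a (Suc n)" by (rule abs_ge_zero)+
    ultimately show ?thesis by argo
  qed
  show ?thesis unfolding slow_def
    by (rule Lim_null_comparison[OF always_eventually lim])
       (unfold real_norm_def, intro allI, rule bound)
qed

text \<open>A discrete intermediate value argument: small steps cannot cross the gap between values
  near 0 and near 1. It becomes the connectedness of the corner.\<close>

lemma slow_two_valued_limit:
  assumes g: "slow g" "unit_seq g" and lim: "(\<lambda>n. g n * (1 - g n)) \<longlonglongrightarrow> 0"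
  shows "g \<longlonglongrightarrow> 0 \<or> g \<longlonglongrightarrow> 1"
proof -
  have g01: "0 \<le> g n" "g n \<le> 1" for n using g(2) by (auto simp: unit_seq_def)
  have "\<forall>\<^sub>F n in sequentially. \<bar>g (Suc n) - g n\<bar> < 1/4"
    using tendsto_rabs_zero[OF g(1)[unfolded slow_def]] by (rule order_tendstoD) auto
  moreover have "\<forall>\<^sub>F n in sequentially. g n * (1 - g n) < 1/8"
    using lim by (rule order_tendstoD) auto
  ultimately have "\<forall>\<^sub>F n in sequentially. \<bar>g (Suc n) - g n\<bar> < 1/4 \<and> g n * (1 - g n) < 1/8"
    by (rule eventually_conj)
  then obtain m where m: "\<And>n. n \<ge> m \<Longrightarrow> \<bar>g (Suc n) - g n\<bar> < 1/4"
      "\<And>n. n \<ge> m \<Longrightarrow> g n * (1 - g n) < 1/8"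
    unfolding eventually_sequentially by blast
  \<comment> \<open>Between 1/4 and 3/4 the product \<open>g n * (1 - g n)\<close> is at least 3/16,
    above the bound 1/8.\<close>
  have gap: "g n < 1/4 \<or> g n > 3/4" if "n \<ge> m" for n
  proof (rule ccontr)
    assume "\<not> ?thesis"
    then have "(g n - 1/4) * (g n - 3/4) \<le> 0"
      by (intro mult_nonneg_nonpos) auto
    then show False using m(2)[OF that] by (simp add: algebra_simps)
  qed
  have lim2: "(\<lambda>n. 2 * (g n * (1 - g n))) \<longlonglongrightarrow> 0"
    using tendsto_mult_left[OF lim, of 2] by simp
  show ?thesis
  proof (cases "g m < 1/4")
    case True
    have lt: "g n < 1/4" if "n \<ge> m" for n
      using that
    proof (induction n rule: dec_induct)
      case (step n) then show ?case using m(1)[of n] gap[of "Suc n"] by force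
    qed (rule True)
    have "g n \<le> 2 * (g n * (1 - g n))" if "n \<ge> m" for n
      using mult_left_mono[of "1/2" "1 - g n" "2 * g n"] lt[OF that] g01[of n] by simp
    then have "g \<longlonglongrightarrow> 0"
      using g01 by (intro Lim_null_comparison[OF _ lim2]) (auto simp: eventually_sequentially)
    then show ?thesis ..
  next
    case False
    have gt: "g n > 3/4" if "n \<ge> m" for n
      using that
    proof (induction n rule: dec_induct)
      case base show ?case using gap[of m] False by auto
    next
      case (step n) then show ?case using m(1)[of n] gap[of "Suc n"] by force
    qed
    have "1 - g n \<le> 2 * (g n * (1 - g n))" if "n \<ge> m" for n
    proof -
      have "1/2 * (1 - g n) \<le> g n * (1 - g n)"
        using gt[OF that] g01[of n] by (intro mult_right_mono) auto
      then show ?thesis by simp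
    qed
    then have "(\<lambda>n. 1 - g n) \<longlonglongrightarrow> 0"
      using g01 by (intro Lim_null_comparison[OF _ lim2]) (auto simp: eventually_sequentially)
    then have "g \<longlonglongrightarrow> 1" using tendsto_diff[OF tendsto_const[of 1], of "\<lambda>n. 1 - g n" 0] by simp
    then show ?thesis ..
  qed
qed

lemma slow_nonconvergent:
  obtains g where "slow g" "unit_seq g" "\<not> convergent g"
proof
  \<comment> \<open>The square root flattens out, which makes this slow, yet along the squares it
    runs through the values of \<open>sin n\<close>.\<close>
  let ?g = "\<lambda>n. (1 + sin (sqrt (real n))) / 2"
  have sq: "(\<lambda>n. sqrt (real (Suc n)) - sqrt (real n)) \<longlonglongrightarrow> 0"
  proof (rule Lim_null_comparison)
    show "(\<lambda>n. inverse (sqrt (real n))) \<longlonglongrightarrow> 0"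
      by (rule tendsto_inverse_0_at_top[OF filterlim_compose[OF sqrt_at_top filterlim_real_sequentially]])
    have "sqrt (real (Suc n)) - sqrt (real n) \<le> inverse (sqrt (real n))" if "n > 0" for n
    proof -
      have "(sqrt (real (Suc n)) - sqrt (real n)) * (sqrt (real (Suc n)) + sqrt (real n))
          = (sqrt (real (Suc n)))\<^sup>2 - (sqrt (real n))\<^sup>2"
        by (simp only: power2_eq_square) (simp only: square_diff_square_factored mult.commute)
      moreover have "(sqrt (real (Suc n)) - sqrt (real n)) * sqrt (real n)
          \<le> (sqrt (real (Suc n)) - sqrt (real n)) * (sqrt (real (Suc n)) + sqrt (real n))"
        by (intro mult_left_mono) auto
      ultimately show ?thesis using that by (simp add: field_simps)
    qed
    then show "\<forall>\<^sub>F n in sequentially. norm (sqrt (real (Suc n)) - sqrt (real n)) \<le> inverse (sqrt (real n))"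
      by (auto simp: eventually_sequentially intro!: exI[of _ 1])
  qed
  have "\<bar>sin x - sin y\<bar> \<le> \<bar>x - y\<bar>" for x y :: real
    using abs_sin_x_le_abs_x[of "(x - y) / 2"] abs_cos_le_one[of "(x + y) / 2"]
      mult_mono[of "\<bar>sin ((x - y) / 2)\<bar>" "\<bar>x - y\<bar> / 2" "\<bar>cos ((x + y) / 2)\<bar>" 1]
    by (simp add: sin_diff_sin abs_mult)
  moreover have "\<bar>?g (Suc n) - ?g n\<bar> \<le> \<bar>sin (sqrt (real (Suc n))) - sin (sqrt (real n))\<bar>" for n
    by (simp add: abs_if field_simps)
  ultimately have "\<bar>?g (Suc n) - ?g n\<bar> \<le> \<bar>sqrt (real (Suc n)) - sqrt (real n)\<bar>" for n
    by (rule order_trans[rotated])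
  then show "slow ?g" unfolding slow_def
    by (intro Lim_null_comparison[OF _ tendsto_rabs_zero[OF sq]]) auto
  show "unit_seq ?g"
    unfolding unit_seq_def
  proof
    fix n show "?g n \<in> {0..1}"
      using sin_ge_minus_one[of "sqrt n"] sin_le_one[of "sqrt n"]
      unfolding atLeastAtMost_iff by argo
  qed
  show "\<not> convergent ?g"
  proof
    assume "convergent ?g"
    then obtain l where l: "?g \<longlonglongrightarrow> l" by (auto simp: convergent_def)
    have sm: "strict_mono (\<lambda>n::nat. n\<^sup>2)" by (intro strict_monoI) (simp add: power_strict_mono)
    have "(\<lambda>n. 2 * ?g (n\<^sup>2) - 1) \<longlonglongrightarrow> 2 * l - 1"
      using LIMSEQ_subseq_LIMSEQ[OF l sm] by (intro tendsto_intros) (simp add: o_def)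
    then have sin: "(\<lambda>n. sin (real n)) \<longlonglongrightarrow> 2 * l - 1" (is "_ \<longlonglongrightarrow> ?L")
      by (simp add: add_divide_distrib)
    have s1: "(\<lambda>n. sin (real (n + 1))) \<longlonglongrightarrow> ?L" and s2: "(\<lambda>n. sin (real (n + 2))) \<longlonglongrightarrow> ?L"
      using LIMSEQ_ignore_initial_segment[OF sin] by blast+
    \<comment> \<open>If \<open>sin n\<close> had a limit, this identity would force
      \<open>cos n\<close> to 0, and the addition formula would then force the limit itself to be 0,
      against the Pythagorean identity.\<close>
    have e1: "2 * sin 1 * cos (real (n + 1)) = sin (real (n + 2)) - sin (real n)" for n
      using sin_add[of "real (n + 1)" 1] sin_diff[of "real (n + 1)" 1] by (simp add: algebra_simps)
    have "(\<lambda>n. 2 * sin 1 * cos (real (n + 1))) \<longlonglongrightarrow> ?L - ?L"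
      unfolding e1 by (intro tendsto_diff s2 sin)
    then have "(\<lambda>n. (2 * sin 1 * cos (real (n + 1))) / (2 * sin 1)) \<longlonglongrightarrow> 0 / (2 * sin 1)"
      using sin_gt_zero[of "1::real"] pi_gt3 by (intro tendsto_divide) auto
    then have c1: "(\<lambda>n. cos (real (n + 1))) \<longlonglongrightarrow> 0"
      using sin_gt_zero[of "1::real"] pi_gt3 by simp
    have c0: "(\<lambda>n. cos (real n)) \<longlonglongrightarrow> 0" using LIMSEQ_offset[OF c1] .
    have "(\<lambda>n. sin (real n) * cos 1 + cos (real n) * sin 1) \<longlonglongrightarrow> ?L * cos 1 + 0 * sin 1"
      by (intro tendsto_intros sin c0)
    then have "(\<lambda>n. sin (real (n + 1))) \<longlonglongrightarrow> ?L * cos 1"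
      by (simp add: sin_add algebra_simps)
    with s1 have "?L = ?L * cos 1" using LIMSEQ_unique by blast
    moreover have "cos (1::real) < 1" using cos_monotone_0_pi[of 0 1] pi_gt3 by simp
    ultimately have L0: "?L = 0" by auto
    have "(\<lambda>n. (sin (real n))\<^sup>2 + (cos (real n))\<^sup>2) \<longlonglongrightarrow> ?L\<^sup>2 + 0\<^sup>2"
      by (intro tendsto_intros sin c0)
    then have "(\<lambda>n::nat. 1::real) \<longlonglongrightarrow> 0" by (simp add: L0)
    then show False using LIMSEQ_unique[OF tendsto_const] by force
  qed
qed

section \<open>The remainder of the natural numbers\<close>

lemma closure_of_value:
  assumes "continuous_map Y euclideanreal \<Psi>" "closed T" "\<And>x. x \<in> S \<Longrightarrow> \<Psi> x \<in> T"
    "y \<in> Y closure_of S"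
  shows "\<Psi> y \<in> T"
proof -
  have "\<Psi> ` (Y closure_of S) \<subseteq> euclideanreal closure_of (\<Psi> ` S)"
    by (rule continuous_map_image_closure_subset[OF assms(1)])
  also have "\<dots> \<subseteq> T"
    by (rule closure_of_minimal) (use assms in auto)
  finally show ?thesis using assms(4) by blast
qed

abbreviation bw :: "((nat \<Rightarrow> real) \<Rightarrow> real) topology" where
  "bw \<equiv> Cech_Stone (discrete_topology UNIV)"

abbreviation pt :: "nat \<Rightarrow> (nat \<Rightarrow> real) \<Rightarrow> real" where
  "pt \<equiv> evaluation (discrete_topology UNIV)"

lemma unit_functions_nat: "unit_functions (discrete_topology UNIV) = {f :: nat \<Rightarrow> real. unit_seq f}"
  by (auto simp: unit_functions_def unit_seq_def continuous_map_in_subtopology)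

lemma pt_apply: "unit_seq f \<Longrightarrow> pt n f = f n"
  by (simp add: evaluation_def unit_functions_nat)

lemma continuous_map_Cech_Stone_value:
  assumes "f \<in> unit_functions X"
  shows "continuous_map (Cech_Stone X) (top_of_set {0..1}) (\<lambda>p. p f)"
  unfolding Cech_Stone_def unit_cube_def
  by (rule continuous_map_from_subtopology[OF continuous_map_product_projection[OF assms]])

lemma continuous_map_value:
  assumes "unit_seq f"
  shows "continuous_map bw (top_of_set {0..1}) (\<lambda>p. p f)" "continuous_map bw euclideanreal (\<lambda>p. p f)"
  using continuous_map_Cech_Stone_value[of f "discrete_topology UNIV"] assms
  by (auto simp: unit_functions_nat continuous_map_in_subtopology)

lemma dense_pt: "bw closure_of (range pt) = topspace bw"
  using evaluation_dense[of "discrete_topology (UNIV :: nat set)"] by simp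

lemma pt_in_bw: "pt n \<in> topspace bw"
  using evaluation_image_subset[of "discrete_topology (UNIV :: nat set)"] by auto

lemma inj_pt: "inj pt"
proof (rule injI)
  fix m n assume "pt m = pt n"
  then have "pt m (indicator {m}) = pt n (indicator {m})" by simp
  moreover have "unit_seq (indicator {m})" by (auto simp: unit_seq_def indicator_def)
  ultimately show "m = n" by (auto simp: pt_apply indicator_def split: if_splits)
qed

text \<open>An open set is contained in the closure of its trace on the dense set
  \<open>range pt\<close>; here the trace is a single point, which is closed.\<close>

lemma openin_pt: "openin bw {pt n}"
proof -
  have u: "unit_seq (indicator {n})" by (auto simp: unit_seq_def indicator_def)
  let ?U = "{p \<in> topspace bw. p (indicator {n}) \<in> {1/2<..}}"
  have U: "openin bw ?U"
    by (rule openin_continuous_map_preimage[OF continuous_map_value(2)[OF u]]) simp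
  have "?U \<inter> range pt = {pt n}"
    using pt_in_bw by (auto simp: pt_apply[OF u] indicator_def of_bool_def split: if_splits)
  then have "?U \<subseteq> bw closure_of {pt n}"
    using openin_Int_closure_of_subset[OF U, of "range pt"] by (auto simp: dense_pt)
  also have "\<dots> = {pt n}"
    using Hausdorff_space_Cech_Stone[of "discrete_topology (UNIV :: nat set)"] pt_in_bw
    by (intro closure_of_closedin closedin_Hausdorff_singleton) auto
  finally have "?U = {pt n}" using pt_in_bw u by (auto simp: pt_apply[OF u])
  with U show ?thesis by simp
qed

text \<open>The space omega*: its points are the free ultrafilters, and \<open>q f\<close> is the
  limit of \<open>f\<close> along the ultrafilter \<open>q\<close>.\<close>

definition ends :: "((nat \<Rightarrow> real) \<Rightarrow> real) set" where
  "ends = topspace bw - range pt"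

lemma ends_subset: "ends \<subseteq> topspace bw"
  by (auto simp: ends_def)

lemma closedin_ends: "closedin bw ends"
proof -
  have "openin bw (\<Union>n. {pt n})" using openin_pt by blast
  then have "openin bw (range pt)" by (simp add: UNION_singleton_eq_range)
  then show ?thesis unfolding ends_def by (intro closedin_diff closedin_topspace)
qed

lemma compactin_ends: "compactin bw ends"
  by (rule closedin_compact_space[OF compact_space_Cech_Stone closedin_ends])

lemma ends_in_closure_of_cofinite:
  assumes "q \<in> ends" "finite F"
  shows "q \<in> bw closure_of (pt ` (- F))"
proof -
  have "range pt = pt ` F \<union> pt ` (- F)" by auto
  then have "topspace bw = bw closure_of (pt ` F) \<union> bw closure_of (pt ` (- F))"
    by (metis dense_pt closure_of_Un)
  moreover have "bw closure_of (pt ` F) = pt ` F"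
    using Hausdorff_space_Cech_Stone[of "discrete_topology (UNIV :: nat set)"] pt_in_bw assms(2)
    by (intro closure_of_closedin closedin_Hausdorff_finite) auto
  ultimately show ?thesis using assms(1) unfolding ends_def by blast
qed

text \<open>An end lies in the closure of every cofinite set of integers, so only the tail of a
  sequence matters. Termwise identities pass to the ends in this way.\<close>

lemma ends_value:
  assumes "continuous_map bw euclideanreal \<Psi>" "closed T" "\<forall>\<^sub>F n in sequentially. \<Psi> (pt n) \<in> T" "q \<in> ends"
  shows "\<Psi> q \<in> T"
proof -
  have fin: "finite {n. \<Psi> (pt n) \<notin> T}"
    using assms(3) by (simp add: cofinite_eq_sequentially[symmetric] eventually_cofinite)
  show ?thesis
    by (rule closure_of_value[OF assms(1,2) _ ends_in_closure_of_cofinite[OF assms(4) fin]]) auto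
qed

lemma ends_limit:
  assumes \<Psi>: "continuous_map bw euclideanreal \<Psi>" and lim: "(\<lambda>n. \<Psi> (pt n)) \<longlonglongrightarrow> c" and q: "q \<in> ends"
  shows "\<Psi> q = c"
proof (rule ccontr)
  assume "\<Psi> q \<noteq> c"
  then have e: "dist c (\<Psi> q) / 2 > 0" by simp
  have "\<forall>\<^sub>F n in sequentially. \<Psi> (pt n) \<in> cball c (dist c (\<Psi> q) / 2)"
    using tendstoD[OF lim e] by (rule eventually_mono) (auto simp: dist_commute)
  from ends_value[OF \<Psi> closed_cball this q] e show False by simp
qed

lemma ends_value_identity:
  assumes "continuous_map bw euclideanreal \<Psi>" "\<And>n. \<Psi> (pt n) = 0" "q \<in> ends"
  shows "\<Psi> q = 0"
  by (rule ends_limit[OF assms(1) _ assms(3)]) (simp add: assms(2))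

lemma unit_seq_mult: "unit_seq f \<Longrightarrow> unit_seq g \<Longrightarrow> unit_seq (\<lambda>n. f n * g n)"
  by (auto simp: unit_seq_def mult_le_one)

lemma ends_mult:
  assumes "unit_seq f" "unit_seq g" "q \<in> ends"
  shows "q (\<lambda>n. f n * g n) = q f * q g"
proof -
  have u: "unit_seq (\<lambda>n. f n * g n)" by (rule unit_seq_mult[OF assms(1,2)])
  have "continuous_map bw euclideanreal (\<lambda>p. p (\<lambda>n. f n * g n) - p f * p g)"
    by (intro continuous_map_diff continuous_map_real_mult continuous_map_value u assms)
  then have "q (\<lambda>n. f n * g n) - q f * q g = 0"
    by (rule ends_value_identity) (use assms in \<open>auto simp: pt_apply u\<close>)
  then show ?thesis by simp
qed

lemma unit_seq_compl: "unit_seq f \<Longrightarrow> unit_seq (\<lambda>n. 1 - f n)"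
  by (auto simp: unit_seq_def)

lemma ends_compl:
  assumes "unit_seq f" "q \<in> ends"
  shows "q (\<lambda>n. 1 - f n) = 1 - q f"
proof -
  have u: "unit_seq (\<lambda>n. 1 - f n)" by (rule unit_seq_compl[OF assms(1)])
  have "continuous_map bw euclideanreal (\<lambda>p. p (\<lambda>n. 1 - f n) - (1 - p f))"
    by (intro continuous_map_diff continuous_map_value u assms) simp
  then have "q (\<lambda>n. 1 - f n) - (1 - q f) = 0"
    by (rule ends_value_identity) (use assms in \<open>auto simp: pt_apply u\<close>)
  then show ?thesis by simp
qed

lemma ends_value_limit:
  assumes "unit_seq f" "f \<longlonglongrightarrow> c" "q \<in> ends"
  shows "q f = c"
  using ends_limit[OF continuous_map_value(2)[OF assms(1)] _ assms(3)] assms by (simp add: pt_apply)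

lemma ends_value_cong:
  assumes "unit_seq f" "unit_seq g" "(\<lambda>n. f n - g n) \<longlonglongrightarrow> 0" "q \<in> ends"
  shows "q f = q g"
proof -
  have "continuous_map bw euclideanreal (\<lambda>p. p f - p g)"
    by (intro continuous_map_diff continuous_map_value assms)
  from ends_limit[OF this _ assms(4)] have "q f - q g = 0"
    using assms by (simp add: pt_apply)
  then show ?thesis by simp
qed

lemma ends_value_unit:
  assumes "q \<in> ends" "unit_seq f"
  shows "q f \<in> {0..1}"
proof -
  have "(\<lambda>p. p f) ` topspace bw \<subseteq> {0..1}"
    using continuous_map_image_subset_topspace[OF continuous_map_value(1)[OF assms(2)]] by simp
  then show ?thesis using assms(1) ends_subset by blast
qed

text \<open>Otherwise the closure would be compact and consist of isolated points, hence be
  finite.\<close>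

lemma ends_accumulate:
  assumes "infinite N"
  obtains q where "q \<in> ends" "q \<in> bw closure_of (pt ` N)"
proof -
  let ?C = "bw closure_of (pt ` N)"
  have "\<not> ?C \<subseteq> range pt"
  proof
    assume sub: "?C \<subseteq> range pt"
    have "compactin bw ?C"
      by (intro closedin_compact_space compact_space_Cech_Stone closedin_closure_of)
    moreover have "?C \<subseteq> \<Union> (range (\<lambda>n. {pt n}))" using sub by auto
    ultimately obtain \<F> where F: "finite \<F>" "\<F> \<subseteq> range (\<lambda>n. {pt n})" "?C \<subseteq> \<Union>\<F>"
      using openin_pt unfolding compactin_def by (metis (no_types, lifting) imageE)
    moreover have "finite (\<Union>\<F>)" using F by (intro finite_Union) auto
    ultimately have "finite ?C" using finite_subset by blast
    moreover have "pt ` N \<subseteq> ?C" using pt_in_bw by (intro closure_of_subset) auto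
    ultimately have "finite (pt ` N)" by (rule finite_subset[rotated])
    then have "finite N" using inj_on_subset[OF inj_pt subset_UNIV] by (rule finite_imageD)
    with assms show False ..
  qed
  then show thesis using that closure_of_subset_topspace[of bw "pt ` N"] unfolding ends_def by blast
qed

text \<open>Applied to an absolute difference, this shows that the values on \<open>ends\<close>
  determine a sequence modulo c_0; a failure of convergence would accumulate at an end.\<close>

lemma ends_eq_limit:
  assumes "unit_seq f" "\<And>q. q \<in> ends \<Longrightarrow> q f = c"
  shows "f \<longlonglongrightarrow> c"
proof (rule ccontr)
  assume "\<not> ?thesis"
  then obtain e where e: "e > 0" "\<not> (\<forall>\<^sub>F n in sequentially. dist (f n) c < e)"
    by (auto simp: tendsto_iff)
  then have "infinite {n. \<not> dist (f n) c < e}"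
    by (simp add: cofinite_eq_sequentially[symmetric] eventually_cofinite)
  then obtain q where q: "q \<in> ends" "q \<in> bw closure_of (pt ` {n. \<not> dist (f n) c < e})"
    by (rule ends_accumulate)
  have "q f \<in> - ball c e"
    by (rule closure_of_value[OF continuous_map_value(2)[OF assms(1)] _ _ q(2)])
       (auto simp: pt_apply assms dist_commute)
  then show False using assms(2)[OF q(1)] e by simp
qed

section \<open>Coarser topologies on the fibres\<close>

definition push :: "(nat \<Rightarrow> nat) \<Rightarrow> ((nat \<Rightarrow> real) \<Rightarrow> real) \<Rightarrow> (nat \<Rightarrow> real) \<Rightarrow> real" where
  "push d p = (\<lambda>f \<in> unit_functions (discrete_topology UNIV). p (f \<circ> d))"

lemma push_apply: "unit_seq f \<Longrightarrow> push d p f = p (f \<circ> d)"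
  by (simp add: push_def unit_functions_nat)

lemma unit_seq_comp: "unit_seq f \<Longrightarrow> unit_seq (f \<circ> d)"
  by (auto simp: unit_seq_def)

lemma push_pt: "push d (pt n) = pt (d n)"
proof
  fix f show "push d (pt n) f = pt (d n) f"
    by (simp add: push_def evaluation_def unit_functions_nat unit_seq_comp)
qed

text \<open>\<open>push d\<close> is the Cech-Stone extension of \<open>d\<close>. Each coordinate
  reads off \<open>f \<circ> d\<close>, and density of the integers keeps the image inside the
  closure.\<close>

lemma continuous_map_push: "continuous_map bw bw (push d)"
proof -
  let ?D = "discrete_topology (UNIV :: nat set)"
  have cube: "continuous_map bw (unit_cube ?D) (push d)"
    unfolding unit_cube_def continuous_map_componentwise
  proof (intro conjI ballI)
    show "push d ` topspace bw \<subseteq> extensional (unit_functions ?D)"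
      by (auto simp: push_def)
    show "continuous_map bw (top_of_set {0..1}) (\<lambda>x. push d x f)" if "f \<in> unit_functions ?D" for f
      using that continuous_map_value(1)[OF unit_seq_comp[of f d]]
      by (simp add: unit_functions_nat push_apply)
  qed
  have "push d ` topspace bw \<subseteq> unit_cube ?D closure_of (push d ` range pt)"
    using continuous_map_image_closure_subset[OF cube, of "range pt"] by (simp add: dense_pt)
  also have "\<dots> \<subseteq> unit_cube ?D closure_of (range pt)"
    by (intro closure_of_mono) (auto simp: push_pt)
  finally show ?thesis
    using cube by (auto simp: Cech_Stone_def[of ?D] continuous_map_in_subtopology)
qed

text \<open>The topology of \<open>fiber d\<close> need not be Hausdorff: it does not separate ends with the same image
  under \<open>push d\<close>.\<close>

definition fiber :: "(nat \<Rightarrow> nat) \<Rightarrow> ((nat \<Rightarrow> real) \<Rightarrow> real) topology" where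
  "fiber d = pullback_topology ends (push d) bw"

lemma push_in_bw: "p \<in> topspace bw \<Longrightarrow> push d p \<in> topspace bw"
  using continuous_map_image_subset_topspace[OF continuous_map_push[of d]] by blast

lemma topspace_fiber: "topspace (fiber d) = ends"
proof -
  have "push d -` topspace bw \<inter> ends = ends" using push_in_bw ends_subset by blast
  then show ?thesis by (simp add: fiber_def topspace_pullback_topology)
qed

lemma continuous_map_fiber_value:
  assumes "unit_seq k"
  shows "continuous_map (fiber d) (top_of_set {0..1}) (\<lambda>p. p (k \<circ> d))"
proof -
  have "continuous_map (fiber d) (top_of_set {0..1}) ((\<lambda>p. p k) \<circ> push d)"
    unfolding fiber_def by (rule continuous_map_pullback[OF continuous_map_value(1)[OF assms]])
  then show ?thesis by (simp add: o_def push_apply[OF assms])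
qed

text \<open>The topology is coarser than the subspace topology of the compact set
  \<open>ends\<close>.\<close>

lemma compact_space_fiber: "compact_space (fiber d)"
proof -
  have c: "compactin (subtopology bw ends) ends"
    using compactin_ends by (simp add: compactin_subtopology)
  have "continuous_map (subtopology bw ends) (fiber d) id"
    unfolding fiber_def
    by (rule continuous_map_pullback')
       (use ends_subset in \<open>auto intro: continuous_map_from_subtopology continuous_map_push\<close>)
  from image_compactin[OF c this] show ?thesis
    by (simp add: compact_space_def topspace_fiber)
qed

lemma normal_space_bw: "normal_space bw"
  by (intro compact_Hausdorff_or_regular_imp_normal_space compact_space_Cech_Stone
      disjI1 Hausdorff_space_Cech_Stone)

text \<open>Open sets of the fibre are saturated for \<open>push d\<close>, so \<open>f\<close>
  factors through the compact image of \<open>ends\<close>. From there Tietze's theorem extends the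
  factor to \<open>bw\<close>, where a function is determined by its values \<open>k\<close> at the
  integers.\<close>

lemma continuous_map_fiberD:
  assumes f: "continuous_map (fiber d) (top_of_set {0..1}) f"
  shows "\<exists>k. unit_seq k \<and> (\<forall>p\<in>ends. f p = p (k \<circ> d))"
proof -
  have pre: "\<exists>O'. openin bw O' \<and> {p \<in> ends. f p \<in> U} = push d -` O' \<inter> ends" if "open U" for U
  proof -
    have "openin (fiber d) {p \<in> ends. f p \<in> U}"
      using openin_continuous_map_preimage[of "fiber d" euclideanreal f U] that f
      by (simp add: topspace_fiber continuous_map_in_subtopology)
    then show ?thesis unfolding fiber_def openin_pullback_topology by auto
  qed
  have eq: "f p = f p'" if "p \<in> ends" "p' \<in> ends" "push d p = push d p'" for p p'
  proof -
    obtain O' where O': "{q \<in> ends. f q \<in> - {f p'}} = push d -` O' \<inter> ends"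
      using pre[of "- {f p'}"] by auto
    have "p' \<notin> push d -` O' \<inter> ends" unfolding O'[symmetric] by simp
    then have "p \<notin> push d -` O' \<inter> ends" using that by simp
    then show ?thesis unfolding O'[symmetric] using that by simp
  qed
  define h where "h s = f (SOME p. p \<in> ends \<and> push d p = s)" for s
  have h: "h (push d p) = f p" if "p \<in> ends" for p
  proof -
    have "\<exists>q. q \<in> ends \<and> push d q = push d p" using that by blast
    from someI_ex[OF this] show ?thesis unfolding h_def by (intro eq that) simp_all
  qed
  let ?S = "push d ` ends"
  have S: "?S \<subseteq> topspace bw" using push_in_bw ends_subset by auto
  have "continuous_map (subtopology bw ?S) euclideanreal h"
    unfolding continuous_map_def
  proof (intro conjI allI impI)
    fix U :: "real set" assume "openin euclideanreal U"
    then obtain O' where O': "openin bw O'" "{p \<in> ends. f p \<in> U} = push d -` O' \<inter> ends"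
      using pre[of U] by auto
    have "{x \<in> topspace (subtopology bw ?S). h x \<in> U} = O' \<inter> ?S"
    proof -
      have "f p \<in> U \<longleftrightarrow> push d p \<in> O'" if "p \<in> ends" for p using O'(2) that by blast
      then show ?thesis using S h by auto
    qed
    then show "openin (subtopology bw ?S) {x \<in> topspace (subtopology bw ?S). h x \<in> U}"
      using O'(1) by (simp add: openin_subtopology_Int)
  qed auto
  moreover have "closedin bw ?S"
    by (rule compactin_imp_closedin[OF Hausdorff_space_Cech_Stone
          image_compactin[OF compactin_ends continuous_map_push]])
  moreover have "h ` ?S \<subseteq> {0..1}"
    using continuous_map_image_subset_topspace[OF f] h by (auto simp: topspace_fiber)
  ultimately obtain H where "continuous_map bw euclideanreal H"
      and H2: "\<And>x. x \<in> ?S \<Longrightarrow> H x = h x" and "H ` topspace bw \<subseteq> {0..1}"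
    using Tietze_extension_closed_real_interval[OF normal_space_bw, of ?S h 0 1] zero_le_one
    by metis
  then have H: "continuous_map bw (top_of_set {0..1}) H"
    by (simp add: continuous_map_in_subtopology image_subset_iff_funcset)
  define k where "k n = H (pt n)" for n
  have k: "unit_seq k"
    using continuous_map_image_subset_topspace[OF H] pt_in_bw unfolding unit_seq_def k_def by fastforce
  have "H p = p k" if "p \<in> topspace bw" for p
  proof -
    have "continuous_map bw euclideanreal (\<lambda>p. H p - p k)"
      using H by (intro continuous_map_diff continuous_map_value k) (auto simp: continuous_map_in_subtopology)
    then have "H p - p k \<in> {0}"
      by (rule closure_of_value[where S = "range pt"]) (use that in \<open>auto simp: dense_pt pt_apply[OF k] k_def[symmetric]\<close>)
    then show ?thesis by simp
  qed
  then have "f p = p (k \<circ> d)" if "p \<in> ends" for p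
    using that h H2[of "push d p"] push_apply[OF k] S by auto
  with k show ?thesis by blast
qed

section \<open>The plank\<close>

text \<open>Cardinality at most the continuum, phrased as being covered by a family indexed by the
  reals, so that unions need only a pairing of reals.\<close>

definition small :: "real set set \<Rightarrow> bool" where
  "small B \<longleftrightarrow> (\<exists>s :: real \<Rightarrow> real set. B \<subseteq> range s)"

lemma small_empty: "small {}"
  by (simp add: small_def)

lemma small_subset: "small B \<Longrightarrow> A \<subseteq> B \<Longrightarrow> small A"
  unfolding small_def by (meson subset_trans)

lemma not_small_UNIV: "\<not> small UNIV"
  unfolding small_def using Cantors_theorem[of "UNIV :: real set"] by (auto simp: top.extremum_unique)

lemma inj_real_pair: "\<exists>c :: real \<times> real \<Rightarrow> real. inj c"
proof -
  have "(card_of ((UNIV :: real set) \<times> (UNIV :: real set)), card_of (UNIV :: real set)) \<in> ordLeq"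
    by (intro ordIso_imp_ordLeq card_of_Times_same_infinite infinite_UNIV_char_0)
  then show ?thesis unfolding card_of_ordLeq[symmetric] by auto
qed

lemma small_UN:
  assumes "\<And>x :: real. small (B x)"
  shows "small (\<Union>x. B x)"
proof -
  have "\<forall>x. \<exists>s :: real \<Rightarrow> real set. B x \<subseteq> range s" using assms by (simp add: small_def)
  then have "\<exists>s :: real \<Rightarrow> real \<Rightarrow> real set. \<forall>x. B x \<subseteq> range (s x)" by (rule choice)
  then obtain s :: "real \<Rightarrow> real \<Rightarrow> real set" where s: "\<And>x. B x \<subseteq> range (s x)" by blast
  obtain e :: "real \<times> real \<Rightarrow> real" where "inj e" using inj_real_pair by blast
  then have "(\<Union>x. B x) \<subseteq> range (\<lambda>t. case inv e t of (x, u) \<Rightarrow> s x u)"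
  proof (intro subsetI)
    fix y assume "y \<in> (\<Union>x. B x)"
    then obtain x u where "y = s x u" using s by blast
    then have "y = (case inv e (e (x, u)) of (x, u) \<Rightarrow> s x u)" using \<open>inj e\<close> by simp
    then show "y \<in> range (\<lambda>t. case inv e t of (x, u) \<Rightarrow> s x u)"
      by (rule range_eqI)
  qed
  then show ?thesis unfolding small_def by blast
qed

lemma small_UN_nat:
  assumes "\<And>n :: nat. small (B n)"
  shows "small (\<Union>n. B n)"
proof (rule small_subset[OF small_UN])
  show "small (B (nat \<lfloor>x\<rfloor>))" for x :: real by (rule assms)
  show "(\<Union>n. B n) \<subseteq> (\<Union>x::real. B (nat \<lfloor>x\<rfloor>))"
  proof
    fix y assume "y \<in> (\<Union>n. B n)"
    then obtain n where "y \<in> B (nat \<lfloor>real n\<rfloor>)" by auto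
    then show "y \<in> (\<Union>x::real. B (nat \<lfloor>x\<rfloor>))" by (rule UN_I[where a = "real n", OF UNIV_I])
  qed
qed

lemma small_Un: "small A \<Longrightarrow> small B \<Longrightarrow> small (A \<union> B)"
proof -
  assume "small A" "small B"
  then have "small (\<Union>n::nat. if n = 0 then A else B)" by (intro small_UN_nat) simp
  moreover have "(\<Union>n::nat. if n = 0 then A else B) = A \<union> B" by (auto split: if_splits)
  ultimately show ?thesis by simp
qed

lemma small_singleton: "small {b}"
  unfolding small_def by (rule exI[of _ "\<lambda>_. b"]) simp

type_synonym index = "real option \<times> real set option"

text \<open>\<open>None\<close> is the added point of either factor; the excluded pair is the
  corner.\<close>

definition indices :: "index set" where
  "indices = - {(None, None)}"

fun dilation :: "index \<Rightarrow> nat \<Rightarrow> nat" where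
  "dilation (Some a, Some b) = id"
| "dilation (Some a, None) = low_pair"
| "dilation (None, b) = high_pair"

text \<open>Since \<open>Some a\<close> and \<open>Some b\<close> are isolated, a neighbourhood of
  an edge point is constrained only along its own row or column, and interior points are
  isolated.\<close>

definition nbhds :: "index \<Rightarrow> index set set" where
  "nbhds i = {J. J \<subseteq> indices \<and> i \<in> J \<and> (case i of
      (Some a, None) \<Rightarrow> small {b. (Some a, Some b) \<notin> J}
    | (None, Some b) \<Rightarrow> countable {a. (Some a, Some b) \<notin> J}
    | _ \<Rightarrow> True)}"

lemma nbhds_indices: "i \<in> indices \<Longrightarrow> indices \<in> nbhds i"
  by (auto simp: nbhds_def indices_def small_empty split: option.splits)

lemma nbhds_self: "J \<in> nbhds i \<Longrightarrow> i \<in> J"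
  by (simp add: nbhds_def)

lemma nbhds_subset: "J \<in> nbhds i \<Longrightarrow> J \<subseteq> indices"
  by (simp add: nbhds_def)

text \<open>Countable unions of countable sets, or of sets of size at most continuum, stay so: every
  index is a P-point.\<close>

lemma nbhds_INT:
  assumes "\<And>n :: nat. J n \<in> nbhds i"
  shows "(\<Inter>n. J n) \<in> nbhds i"
proof -
  have "{b. (Some a, Some b) \<notin> (\<Inter>n. J n)} = (\<Union>n. {b. (Some a, Some b) \<notin> J n})"
    "{a. (Some a, Some b) \<notin> (\<Inter>n. J n)} = (\<Union>n. {a. (Some a, Some b) \<notin> J n})" for a b
    by auto
  note sets = this
  have "(\<Inter>n. J n) \<subseteq> indices" "i \<in> (\<Inter>n. J n)"
    using nbhds_subset[OF assms[of 0]] nbhds_self[OF assms] by auto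
  moreover have "small {b. (Some a, Some b) \<notin> (\<Inter>n. J n)}" if "i = (Some a, None)" for a
    unfolding sets by (rule small_UN_nat) (use assms that in \<open>simp add: nbhds_def\<close>)
  moreover have "countable {a. (Some a, Some b) \<notin> (\<Inter>n. J n)}" if "i = (None, Some b)" for b
    unfolding sets by (rule countable_UN) (use assms that in \<open>simp_all add: nbhds_def\<close>)
  ultimately show ?thesis
    unfolding nbhds_def by (cases i) (simp split: option.splits)
qed

lemma nbhds_Int:
  assumes "J \<in> nbhds i" "J' \<in> nbhds i"
  shows "J \<inter> J' \<in> nbhds i"
proof -
  have "(\<Inter>n. if n = (0::nat) then J else J') \<in> nbhds i" by (rule nbhds_INT) (use assms in auto)
  moreover have "(\<Inter>n. if n = (0::nat) then J else J') = J \<inter> J'" by (auto split: if_splits)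
  ultimately show ?thesis by simp
qed

lemma nbhds_finite_INT:
  assumes "finite F" "i \<in> indices" "\<And>x. x \<in> F \<Longrightarrow> J x \<in> nbhds i"
  shows "\<exists>J'\<in>nbhds i. \<forall>x\<in>F. J' \<subseteq> J x"
  using assms
proof (induction F rule: finite_induct)
  case empty then show ?case using nbhds_indices by blast
next
  case (insert x F)
  then obtain J' where "J' \<in> nbhds i" "\<forall>x\<in>F. J' \<subseteq> J x" by auto
  then show ?case using insert.prems by (intro bexI[of _ "J' \<inter> J x"] nbhds_Int) auto
qed

text \<open>The product of the two one-point P-spaces \<open>real option\<close> (cocountable neighbourhoods of \<open>None\<close>) and
  \<open>real set option\<close> (neighbourhoods of \<open>None\<close> with small complement), minus the corner, with a copy of
  the ends over each point.  Along the two edges only functions that respect \<open>low_pair\<close> and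
  \<open>high_pair\<close>, respectively, stay continuous.\<close>

definition plank_open :: "(index \<times> ((nat \<Rightarrow> real) \<Rightarrow> real)) set \<Rightarrow> bool" where
  "plank_open U \<longleftrightarrow> U \<subseteq> indices \<times> ends \<and>
     (\<forall>i p. (i, p) \<in> U \<longrightarrow>
        (\<exists>J\<in>nbhds i. \<exists>V. openin (fiber (dilation i)) V \<and> p \<in> V \<and> J \<times> V \<subseteq> U))"

definition plank :: "(index \<times> ((nat \<Rightarrow> real) \<Rightarrow> real)) topology" where
  "plank = topology plank_open"

lemma openin_plank: "openin plank = plank_open"
proof -
  have "istopology plank_open"
    unfolding istopology_def
  proof (intro conjI allI impI)
    fix S T assume ST: "plank_open S" "plank_open T"
    show "plank_open (S \<inter> T)"
      unfolding plank_open_def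
    proof (intro conjI allI impI)
      show "S \<inter> T \<subseteq> indices \<times> ends" using ST by (auto simp: plank_open_def)
      fix i p assume ip: "(i, p) \<in> S \<inter> T"
      obtain J V where J: "J \<in> nbhds i" "openin (fiber (dilation i)) V" "p \<in> V" "J \<times> V \<subseteq> S"
        using ST(1) ip unfolding plank_open_def by (meson IntD1)
      obtain J' V' where J': "J' \<in> nbhds i" "openin (fiber (dilation i)) V'" "p \<in> V'" "J' \<times> V' \<subseteq> T"
        using ST(2) ip unfolding plank_open_def by (meson IntD2)
      show "\<exists>J\<in>nbhds i. \<exists>V. openin (fiber (dilation i)) V \<and> p \<in> V \<and> J \<times> V \<subseteq> S \<inter> T"
        using J J' by (intro bexI[of _ "J \<inter> J'"] exI[of _ "V \<inter> V'"] nbhds_Int conjI openin_Int) auto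
    qed
  next
    fix K assume K: "\<forall>S\<in>K. plank_open S"
    show "plank_open (\<Union>K)"
      unfolding plank_open_def
    proof (intro conjI allI impI)
      show "\<Union>K \<subseteq> indices \<times> ends" using K by (auto simp: plank_open_def)
      fix i p assume "(i, p) \<in> \<Union>K"
      then obtain S where S: "S \<in> K" "(i, p) \<in> S" by blast
      then obtain J V where "J \<in> nbhds i" "openin (fiber (dilation i)) V" "p \<in> V" "J \<times> V \<subseteq> S"
        using K unfolding plank_open_def by meson
      then show "\<exists>J\<in>nbhds i. \<exists>V. openin (fiber (dilation i)) V \<and> p \<in> V \<and> J \<times> V \<subseteq> \<Union>K"
        using S(1) by (meson Union_upper subset_trans)
    qed
  qed
  then show ?thesis unfolding plank_def by (rule topology_inverse')
qed

lemma topspace_plank: "topspace plank = indices \<times> ends"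
proof -
  have "plank_open (indices \<times> ends)"
    unfolding plank_open_def
  proof (intro conjI allI impI subset_refl)
    fix i p assume "(i, p) \<in> indices \<times> ends"
    then show "\<exists>J\<in>nbhds i. \<exists>V. openin (fiber (dilation i)) V \<and> p \<in> V \<and> J \<times> V \<subseteq> indices \<times> ends"
      using openin_topspace[of "fiber (dilation i)"]
      by (intro bexI[of _ indices] exI[of _ ends]) (auto simp: topspace_fiber nbhds_indices)
  qed
  then have "openin plank (indices \<times> ends)" by (simp only: openin_plank)
  moreover have "U \<subseteq> indices \<times> ends" if "openin plank U" for U
    using that by (simp only: openin_plank plank_open_def)
  ultimately show ?thesis
    using openin_topspace[of plank] openin_subset[of plank "indices \<times> ends"] by blast
qed

text \<open>Near \<open>i\<close>, \<open>f\<close> ignores the index and is continuous on the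
  fibre, so a preimage contains boxes \<open>J \<times> V\<close>.
  \<open>continuous_map_plankD\<close> is the converse.\<close>

lemma continuous_map_plankI:
  assumes "\<And>i. i \<in> indices \<Longrightarrow> \<exists>k. \<exists>J\<in>nbhds i. unit_seq k \<and>
    (\<forall>j\<in>J. \<forall>p\<in>ends. f (j, p) = p (k \<circ> dilation i))"
  shows "continuous_map plank (top_of_set {0..1}) f"
proof -
  have unit: "f x \<in> {0..1}" if x: "x \<in> topspace plank" for x
  proof -
    obtain i p where ip: "x = (i, p)" "i \<in> indices" "p \<in> ends" using x by (auto simp: topspace_plank)
    obtain k J where "J \<in> nbhds i" "unit_seq k" "\<And>j p. j \<in> J \<Longrightarrow> p \<in> ends \<Longrightarrow> f (j, p) = p (k \<circ> dilation i)"
      using assms[OF ip(2)] by blast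
    then show ?thesis using ip nbhds_self ends_value_unit[OF ip(3) unit_seq_comp] by metis
  qed
  have "continuous_map plank euclideanreal f"
    unfolding continuous_map_def
  proof (intro conjI allI impI)
    fix U :: "real set" assume U: "openin euclideanreal U"
    show "openin plank {x \<in> topspace plank. f x \<in> U}"
      unfolding openin_plank plank_open_def
    proof (intro conjI allI impI)
      show "{x \<in> topspace plank. f x \<in> U} \<subseteq> indices \<times> ends" by (auto simp: topspace_plank)
      fix i p assume "(i, p) \<in> {x \<in> topspace plank. f x \<in> U}"
      then have ip: "i \<in> indices" "p \<in> ends" "f (i, p) \<in> U" by (auto simp: topspace_plank)
      obtain k J where kJ: "J \<in> nbhds i" "unit_seq k" "\<And>j p. j \<in> J \<Longrightarrow> p \<in> ends \<Longrightarrow> f (j, p) = p (k \<circ> dilation i)"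
        using assms[OF ip(1)] by blast
      let ?V = "{q \<in> topspace (fiber (dilation i)). q (k \<circ> dilation i) \<in> U}"
      have "openin (fiber (dilation i)) ?V"
        using continuous_map_fiber_value[OF kJ(2), of "dilation i"] U
        by (intro openin_continuous_map_preimage[where Y = euclideanreal]) (auto simp: continuous_map_in_subtopology)
      moreover have "p \<in> ?V" using ip kJ(3)[OF nbhds_self[OF kJ(1)] ip(2)] by (simp add: topspace_fiber)
      moreover have "J \<times> ?V \<subseteq> {x \<in> topspace plank. f x \<in> U}"
        using kJ(3) nbhds_subset[OF kJ(1)] by (auto simp: topspace_plank topspace_fiber)
      ultimately show "\<exists>J\<in>nbhds i. \<exists>V. openin (fiber (dilation i)) V \<and> p \<in> V \<and> J \<times> V \<subseteq> {x \<in> topspace plank. f x \<in> U}"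
        using kJ(1) by blast
    qed
  qed auto
  then show ?thesis using unit by (auto simp: continuous_map_in_subtopology)
qed

text \<open>Compactness of the fiber makes the neighbourhood in the index direction uniform, and closure of
  \<open>nbhds i\<close> under countable intersections makes the approximation exact.\<close>

lemma continuous_map_plankD:
  assumes f: "continuous_map plank (top_of_set {0..1}) f" and i: "i \<in> indices"
  shows "\<exists>k. \<exists>J\<in>nbhds i. unit_seq k \<and> (\<forall>j\<in>J. \<forall>p\<in>ends. f (j, p) = p (k \<circ> dilation i))"
proof -
  let ?T = "fiber (dilation i)"
  have near: "\<exists>J\<in>nbhds i. \<exists>V. openin ?T V \<and> p \<in> V \<and> (\<forall>j\<in>J. \<forall>q\<in>V. f (j, q) \<in> U)"
    if "p \<in> ends" "open U" "f (i, p) \<in> U" for p U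
  proof -
    have "openin plank {x \<in> topspace plank. f x \<in> U}"
      using openin_continuous_map_preimage[of plank euclideanreal f U] f that
      by (simp add: continuous_map_in_subtopology)
    then have *: "plank_open {x \<in> topspace plank. f x \<in> U}" by (simp add: openin_plank)
    have ip: "(i, p) \<in> {x \<in> topspace plank. f x \<in> U}" using that i by (simp add: topspace_plank)
    obtain J V where "J \<in> nbhds i" "openin ?T V" "p \<in> V" "J \<times> V \<subseteq> {x \<in> topspace plank. f x \<in> U}"
      using * ip unfolding plank_open_def by blast
    then show ?thesis by (intro bexI[of _ J] exI[of _ V]) auto
  qed
  have "continuous_map ?T euclideanreal (\<lambda>p. f (i, p))"
    unfolding continuous_map_def
  proof (intro conjI allI impI)
    fix U :: "real set" assume U: "openin euclideanreal U"
    show "openin ?T {p \<in> topspace ?T. f (i, p) \<in> U}"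
    proof (subst openin_subopen, intro ballI)
      fix p assume "p \<in> {p \<in> topspace ?T. f (i, p) \<in> U}"
      then obtain J V where "J \<in> nbhds i" "openin ?T V" "p \<in> V" "\<forall>j\<in>J. \<forall>q\<in>V. f (j, q) \<in> U"
        using near[of p U] U by (auto simp: topspace_fiber)
      then show "\<exists>T. openin ?T T \<and> p \<in> T \<and> T \<subseteq> {p \<in> topspace ?T. f (i, p) \<in> U}"
        using nbhds_self openin_subset by (intro exI[of _ V]) blast
    qed
  qed auto
  moreover have "f (i, p) \<in> {0..1}" if "p \<in> ends" for p
    using f that i by (auto simp: continuous_map_in_subtopology topspace_plank)
  ultimately have "continuous_map ?T (top_of_set {0..1}) (\<lambda>p. f (i, p))"
    by (auto simp: continuous_map_in_subtopology topspace_fiber)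
  from continuous_map_fiberD[OF this] obtain k
    where k: "unit_seq k" "\<And>p. p \<in> ends \<Longrightarrow> f (i, p) = p (k \<circ> dilation i)" by blast
  have "\<exists>J\<in>nbhds i. \<forall>j\<in>J. \<forall>p\<in>ends. \<bar>f (j, p) - f (i, p)\<bar> < e" if e: "e > 0" for e
  proof -
    define P where "P V J \<longleftrightarrow> J \<in> nbhds i \<and> (\<forall>j\<in>J. \<forall>q\<in>V. \<bar>f (j, q) - f (i, q)\<bar> < e)" for V J
    let ?\<V> = "{V. openin ?T V \<and> (\<exists>J. P V J)}"
    have "ends \<subseteq> \<Union>?\<V>"
    proof
      fix p assume p: "p \<in> ends"
      obtain J V where JV: "J \<in> nbhds i" "openin ?T V" "p \<in> V" "\<forall>j\<in>J. \<forall>q\<in>V. f (j, q) \<in> ball (f (i, p)) (e/2)"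
        using near[OF p, of "ball (f (i, p)) (e/2)"] e by auto
      have "\<bar>f (j, q) - f (i, q)\<bar> < e" if "j \<in> J" "q \<in> V" for j q
      proof -
        have "\<bar>f (i, p) - f (j, q)\<bar> < e/2" "\<bar>f (i, p) - f (i, q)\<bar> < e/2"
          using JV(4) nbhds_self[OF JV(1)] that by (auto simp: dist_real_def)
        then show ?thesis by linarith
      qed
      then have "P V J" using JV(1) unfolding P_def by blast
      then show "p \<in> \<Union>?\<V>" using JV by blast
    qed
    then obtain \<F> where \<F>: "finite \<F>" "\<F> \<subseteq> ?\<V>" "ends \<subseteq> \<Union>\<F>"
      using compact_space_fiber[of "dilation i"] unfolding compact_space_alt topspace_fiber
      by (metis (no_types, lifting) mem_Collect_eq)
    then have "\<forall>V\<in>\<F>. \<exists>J. P V J" by blast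
    then obtain J where J: "\<forall>V\<in>\<F>. P V (J V)" by (rule bchoice[THEN exE])
    then obtain J' where J': "J' \<in> nbhds i" "\<forall>V\<in>\<F>. J' \<subseteq> J V"
      using nbhds_finite_INT[OF \<F>(1) i, of J] unfolding P_def by blast
    show ?thesis
    proof (intro bexI[OF _ J'(1)] ballI)
      fix j p assume jp: "j \<in> J'" "p \<in> ends"
      then obtain V where "V \<in> \<F>" "p \<in> V" using \<F>(3) by blast
      then show "\<bar>f (j, p) - f (i, p)\<bar> < e" using J J'(2) jp(1) unfolding P_def by blast
    qed
  qed
  then have "\<exists>J\<in>nbhds i. \<forall>j\<in>J. \<forall>p\<in>ends. \<bar>f (j, p) - f (i, p)\<bar> < inverse (real (Suc n))" for n
    by simp
  then obtain J where J: "\<And>n. J n \<in> nbhds i"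
    "\<And>n j p. j \<in> J n \<Longrightarrow> p \<in> ends \<Longrightarrow> \<bar>f (j, p) - f (i, p)\<bar> < inverse (real (Suc n))"
    by metis
  show ?thesis
  proof (intro exI[of _ k] bexI[OF _ nbhds_INT[of J, OF J(1)]] conjI ballI k(1))
    fix j p assume jp: "j \<in> (\<Inter>n. J n)" "p \<in> ends"
    have "f (j, p) = f (i, p)"
    proof (rule ccontr)
      assume "f (j, p) \<noteq> f (i, p)"
      then obtain n where "inverse (real (Suc n)) < \<bar>f (j, p) - f (i, p)\<bar>"
        using reals_Archimedean[of "\<bar>f (j, p) - f (i, p)\<bar>"] by auto
      with J(2)[of j n p] jp show False by auto
    qed
    then show "f (j, p) = p (k \<circ> dilation i)" using k(2) jp by simp
  qed
qed

text \<open>For countable \<open>A\<close> and small \<open>B\<close> these are the traces on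
  \<open>indices\<close> of the basic neighbourhoods of the removed corner.\<close>

definition core :: "real set \<Rightarrow> real set set \<Rightarrow> index set" where
  "core A B = {(a, b). (a, b) \<in> indices \<and> a \<notin> Some ` A \<and> b \<notin> Some ` B}"

lemma core_subset: "core A B \<subseteq> indices"
  by (auto simp: core_def)

lemma uncountable_avoid:
  assumes "countable (A :: real set)"
  obtains a where "a \<notin> A"
proof -
  have "A \<noteq> UNIV" using assms uncountable_UNIV_real by auto
  then show thesis using that by blast
qed

lemma small_avoid:
  assumes "small B"
  obtains b where "b \<notin> B"
proof -
  have "B \<noteq> UNIV" using assms not_small_UNIV by auto
  then show thesis using that by blast
qed

text \<open>Rows are exceptional only for small sets of columns, and there are few enough rows to discard all
  exceptional columns at once; a single good column then links almost all rows.\<close>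

lemma continuous_map_plank_core:
  assumes f: "continuous_map plank (top_of_set {0..1}) f"
  obtains g A B where "slow g" "unit_seq g" "countable A" "small B"
    "\<And>i p. i \<in> core A B \<Longrightarrow> p \<in> ends \<Longrightarrow> f (i, p) = p g"
proof -
  have "\<exists>k B. unit_seq k \<and> small B \<and> (\<forall>p\<in>ends. f ((Some a, None), p) = p (k \<circ> low_pair) \<and>
      (\<forall>b. b \<notin> B \<longrightarrow> f ((Some a, Some b), p) = f ((Some a, None), p)))" for a
  proof -
    have "(Some a, None) \<in> indices" by (simp add: indices_def)
    from continuous_map_plankD[OF f this] obtain k J where kJ: "J \<in> nbhds (Some a, None)" "unit_seq k"
      "\<And>j p. j \<in> J \<Longrightarrow> p \<in> ends \<Longrightarrow> f (j, p) = p (k \<circ> dilation (Some a, None))"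
      by blast
    have "small {b. (Some a, Some b) \<notin> J}" using kJ(1) by (simp add: nbhds_def)
    then show ?thesis using kJ nbhds_self[OF kJ(1)]
      by (intro exI[of _ k] exI[of _ "{b. (Some a, Some b) \<notin> J}"]) auto
  qed
  then obtain k B where row: "\<And>a. unit_seq (k a)" "\<And>a. small (B a)"
    "\<And>a p. p \<in> ends \<Longrightarrow> f ((Some a, None), p) = p (k a \<circ> low_pair)"
    "\<And>a b p. p \<in> ends \<Longrightarrow> b \<notin> B a \<Longrightarrow> f ((Some a, Some b), p) = f ((Some a, None), p)"
    by metis
  have "\<exists>l A. unit_seq l \<and> countable A \<and> (\<forall>p\<in>ends. f ((None, Some b), p) = p (l \<circ> high_pair) \<and>
      (\<forall>a. a \<notin> A \<longrightarrow> f ((Some a, Some b), p) = f ((None, Some b), p)))" for b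
  proof -
    have "(None, Some b) \<in> indices" by (simp add: indices_def)
    from continuous_map_plankD[OF f this] obtain k J where kJ: "J \<in> nbhds (None, Some b)" "unit_seq k"
      "\<And>j p. j \<in> J \<Longrightarrow> p \<in> ends \<Longrightarrow> f (j, p) = p (k \<circ> dilation (None, Some b))"
      by blast
    have "countable {a. (Some a, Some b) \<notin> J}" using kJ(1) by (simp add: nbhds_def)
    then show ?thesis using kJ nbhds_self[OF kJ(1)]
      by (intro exI[of _ k] exI[of _ "{a. (Some a, Some b) \<notin> J}"]) auto
  qed
  then obtain l A where col: "\<And>b. unit_seq (l b)" "\<And>b. countable (A b)"
    "\<And>b p. p \<in> ends \<Longrightarrow> f ((None, Some b), p) = p (l b \<circ> high_pair)"
    "\<And>a b p. p \<in> ends \<Longrightarrow> a \<notin> A b \<Longrightarrow> f ((Some a, Some b), p) = f ((None, Some b), p)"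
    by metis
  let ?B = "\<Union>a. B a"
  have B: "small ?B" by (intro small_UN row)
  then obtain b0 where b0: "b0 \<notin> ?B" by (rule small_avoid)
  define g where "g = l b0 \<circ> high_pair"
  have g: "unit_seq g" unfolding g_def by (intro unit_seq_comp col)
  \<comment> \<open>Along the column \<open>b0\<close>: row edge, interior point and column edge
    carry the same function.\<close>
  have edge: "f ((Some a, None), p) = p g" if "a \<notin> A b0" "p \<in> ends" for a p
    using row(4)[of p b0 a] col(4)[of p a b0] col(3)[of p b0] that b0 by (simp add: g_def)
  show thesis
  proof
    \<comment> \<open>One good row suffices: there \<open>g\<close>, a function of
      \<open>high_pair\<close>, agrees at all ends with a function of \<open>low_pair\<close>, hence
      modulo c_0.\<close>
    obtain a where a: "a \<notin> A b0" by (rule uncountable_avoid[OF col(2)])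
    have "(\<lambda>n. g n - (k a \<circ> low_pair) n) \<longlonglongrightarrow> 0"
    proof -
      let ?k = "k a \<circ> low_pair"
      have k: "unit_seq ?k" by (intro unit_seq_comp row)
      have u: "unit_seq (\<lambda>n. \<bar>g n - ?k n\<bar>)"
        unfolding unit_seq_def
      proof
        fix n show "\<bar>g n - ?k n\<bar> \<in> {0..1}"
          using g[unfolded unit_seq_def, rule_format, of n] k[unfolded unit_seq_def, rule_format, of n]
          by (auto simp: abs_le_iff)
      qed
      have "(\<lambda>n. \<bar>g n - ?k n\<bar>) \<longlonglongrightarrow> 0"
      proof (rule ends_eq_limit[OF u])
        fix q assume q: "q \<in> ends"
        have c: "continuous_map bw euclideanreal (\<lambda>p. \<bar>p g - p ?k\<bar> - p (\<lambda>n. \<bar>g n - ?k n\<bar>))"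
          by (intro continuous_map_diff continuous_map_real_abs continuous_map_value g k u)
        have "\<bar>q g - q ?k\<bar> - q (\<lambda>n. \<bar>g n - ?k n\<bar>) = 0"
          by (rule ends_limit[OF c _ q]) (simp only: pt_apply[OF g] pt_apply[OF k] pt_apply[OF u] diff_self tendsto_const)
        moreover have "q g = q ?k" using edge[OF a q] row(3)[OF q] by simp
        ultimately show "q (\<lambda>n. \<bar>g n - ?k n\<bar>) = 0" by simp
      qed
      then show ?thesis by (rule tendsto_rabs_zero_cancel)
    qed
    then show "slow g"
      by (intro slow_if_both_pairs[where k = "k a" and l = "l b0"]) (simp_all add: g_def)
    show "unit_seq g" "countable (A b0)" "small ?B" by (fact g col B)+
    fix i p assume i: "i \<in> core (A b0) ?B" and p: "p \<in> ends"
    obtain a b where ab: "i = (a, b)" by (cases i)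
    show "f (i, p) = p g"
    proof (cases a)
      case (Some x)
      then have x: "x \<notin> A b0" using i ab by (auto simp: core_def)
      show ?thesis
      proof (cases b)
        case None
        then show ?thesis using edge[OF x p] ab Some by simp
      next
        case (Some y)
        then have "y \<notin> B x" using i ab by (auto simp: core_def)
        then show ?thesis using row(4)[OF p, of y x] edge[OF x p] ab Some \<open>a = _\<close> by simp
      qed
    next
      case None
      then obtain y where y: "b = Some y" "y \<notin> ?B"
        using i ab by (cases b) (auto simp: core_def indices_def)
      \<comment> \<open>A row good for both columns \<open>y\<close> and \<open>b0\<close> ties the
        edge point of column \<open>y\<close> to \<open>g\<close>.\<close>
      obtain x where "x \<notin> A b0 \<union> A y" by (rule uncountable_avoid[of "A b0 \<union> A y"]) (auto simp: col)
      then show ?thesis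
        using row(4)[OF p, of y x] edge[of x p] col(4)[OF p, of x y] p y ab None by auto
    qed
  qed
qed

text \<open>The tool for building functions: near the corner the given values are discarded in
  favour of \<open>h\<close>, and the rest is changed termwise by \<open>\<theta>\<close>, which may
  be discontinuous since it acts on sequences and not on their limits. Slowness of \<open>h\<close>
  makes it fit both edges.\<close>

lemma continuous_map_plank_piecewise:
  assumes f: "continuous_map plank (top_of_set {0..1}) f"
    and A: "countable A" and B: "small B" and h: "slow h" "unit_seq h"
    and \<theta>: "\<And>x. x \<in> {0..1} \<Longrightarrow> \<theta> x \<in> {0..1}"
  obtains k where "continuous_map plank (top_of_set {0..1}) k"
    "\<And>i p. i \<in> core A B \<Longrightarrow> p \<in> ends \<Longrightarrow> k (i, p) = p h"
    "\<And>i. i \<in> indices - core A B \<Longrightarrow>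
       \<exists>\<phi>. unit_seq \<phi> \<and> (\<forall>p\<in>ends. f (i, p) = p \<phi> \<and> k (i, p) = p (\<theta> \<circ> \<phi>))"
proof -
  obtain c J where J: "\<And>i. i \<in> indices \<Longrightarrow> J i \<in> nbhds i" and c: "\<And>i. i \<in> indices \<Longrightarrow> unit_seq (c i)"
    and fc: "\<And>i j p. i \<in> indices \<Longrightarrow> j \<in> J i \<Longrightarrow> p \<in> ends \<Longrightarrow> f (j, p) = p (c i \<circ> dilation i)"
  proof -
    have "\<forall>i. \<exists>k J. i \<in> indices \<longrightarrow> J \<in> nbhds i \<and> unit_seq k \<and>
        (\<forall>j\<in>J. \<forall>p\<in>ends. f (j, p) = p (k \<circ> dilation i))"
      using continuous_map_plankD[OF f] by blast
    then obtain c J where "\<forall>i. i \<in> indices \<longrightarrow> J i \<in> nbhds i \<and> unit_seq (c i) \<and>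
        (\<forall>j\<in>J i. \<forall>p\<in>ends. f (j, p) = p (c i \<circ> dilation i))"
      unfolding choice_iff by blast
    then show thesis using that by blast
  qed
  \<comment> \<open>The sequence representing \<open>f\<close> at an index is unique only modulo
    c_0, which a discontinuous \<open>\<theta>\<close> does not respect. So all indices near an
    exceptional edge point must use the sequence of that point; a point in both an exceptional row
    and an exceptional column follows its row.\<close>
  define \<rho> :: "index \<Rightarrow> index" where
    "\<rho> i = (if fst i \<in> Some ` A then (fst i, None) else (None, snd i))" for i
  define code where
    "code i = (if i \<in> J (\<rho> i) then c (\<rho> i) \<circ> dilation (\<rho> i) else c i \<circ> dilation i)" for i
  define k :: "index \<times> ((nat \<Rightarrow> real) \<Rightarrow> real) \<Rightarrow> real" where "k = (\<lambda>(i, p). if i \<in> core A B then p h else p (\<theta> \<circ> code i))"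
  have \<rho>: "\<rho> i \<in> indices" if "i \<in> indices - core A B" for i
    using that by (cases i) (auto simp: \<rho>_def indices_def core_def)
  have u\<theta>: "unit_seq (\<theta> \<circ> \<phi>)" if "unit_seq \<phi>" for \<phi>
    using that \<theta> by (auto simp: unit_seq_def)
  have code: "unit_seq (code i)" "\<forall>p\<in>ends. f (i, p) = p (code i)" if "i \<in> indices - core A B" for i
    using that \<rho>[OF that] c[of i] c[of "\<rho> i"] fc[of i i] fc[of "\<rho> i" i] nbhds_self[OF J[of i]]
    by (auto simp: code_def intro: unit_seq_comp)
  \<comment> \<open>The values of \<open>h\<close> at even numbers, read at block numbers, give
    \<open>h\<close> at the ends for either pairing.\<close>
  have h2: "unit_seq (\<lambda>n. h (2 * n))" using h(2) by (simp add: unit_seq_def)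
  have low: "p h = p ((\<lambda>n. h (2 * n)) \<circ> low_pair)" if "p \<in> ends" for p
    using ends_value_cong[OF h(2) unit_seq_comp[OF h2, of low_pair] _ that] slow_subseq(1)[OF h(1)]
    by (simp add: o_def)
  have high: "p h = p ((\<lambda>n. h (2 * n)) \<circ> high_pair)" if "p \<in> ends" for p
    using ends_value_cong[OF h(2) unit_seq_comp[OF h2, of high_pair] _ that] slow_subseq(2)[OF h(1)]
    by (simp add: o_def)
  show thesis
  proof
    show "continuous_map plank (top_of_set {0..1}) k"
    proof (rule continuous_map_plankI)
      fix i assume i: "i \<in> indices"
      obtain a b where ab: "i = (a, b)" by (cases i)
      show "\<exists>l. \<exists>J\<in>nbhds i. unit_seq l \<and> (\<forall>j\<in>J. \<forall>p\<in>ends. k (j, p) = p (l \<circ> dilation i))"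
      proof (cases a)
        case a: (Some x)
        show ?thesis
        proof (cases b)
          case b: (Some y)
          have "{i} \<in> nbhds i" using i by (simp add: nbhds_def ab a b)
          then show ?thesis
            using h(2) u\<theta>[OF code(1)[of i]] i
            by (intro exI[of _ "if i \<in> core A B then h else \<theta> \<circ> code i"] bexI[of _ "{i}"])
               (auto simp: k_def ab a b)
        next
          case b: None
          show ?thesis
          proof (cases "x \<in> A")
            case True
            let ?J = "{(a', b'). a' = a \<and> (a', b') \<in> J i}"
            have "?J \<in> nbhds i" using J[OF i] by (auto simp: nbhds_def ab a b)
            moreover have "k (j, p) = p ((\<theta> \<circ> c i) \<circ> dilation i)" if "j \<in> ?J" "p \<in> ends" for j p
            proof -
              have "\<rho> j = i" "j \<notin> core A B" "j \<in> J i" using that True by (auto simp: \<rho>_def core_def ab a b)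
              then show ?thesis by (simp add: k_def code_def o_assoc)
            qed
            ultimately show ?thesis using u\<theta>[OF c[OF i]] by blast
          next
            case False
            let ?J = "{(a', b'). a' = a \<and> b' \<notin> Some ` B}"
            have "{y. (Some x, Some y) \<notin> ?J} = B" by (auto simp: a)
            then have "?J \<in> nbhds i" using B by (auto simp: nbhds_def ab a b indices_def)
            moreover have "k (j, p) = p ((\<lambda>n. h (2 * n)) \<circ> dilation i)" if "j \<in> ?J" "p \<in> ends" for j p
            proof -
              have "j \<in> core A B" using that False by (auto simp: core_def indices_def a)
              then show ?thesis using low[OF that(2)] by (simp add: k_def ab a b)
            qed
            ultimately show ?thesis using h2 by blast
          qed
        qed
      next
        case a: None
        then obtain y where b: "b = Some y" using i ab by (cases b) (auto simp: indices_def)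
        show ?thesis
        proof (cases "y \<in> B")
          case True
          \<comment> \<open>Points in exceptional rows follow their row and are removed;
            \<open>A\<close> is countable, so a neighbourhood remains.\<close>
          let ?J = "{(a', b'). b' = b \<and> a' \<notin> Some ` A \<and> (a', b') \<in> J i}"
          have "{x. (Some x, Some y) \<notin> ?J} = A \<union> {x. (Some x, Some y) \<notin> J i}" by (auto simp: b)
          then have "?J \<in> nbhds i" using J[OF i] A by (auto simp: nbhds_def ab a b)
          moreover have "k (j, p) = p ((\<theta> \<circ> c i) \<circ> dilation i)" if "j \<in> ?J" "p \<in> ends" for j p
          proof -
            have "\<rho> j = i" "j \<notin> core A B" "j \<in> J i" using that True by (auto simp: \<rho>_def core_def ab a b)
            then show ?thesis by (simp add: k_def code_def o_assoc)
          qed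
          ultimately show ?thesis using u\<theta>[OF c[OF i]] by blast
        next
          case False
          let ?J = "{(a', b'). b' = b \<and> a' \<notin> Some ` A}"
          have "{x. (Some x, Some y) \<notin> ?J} = A" by (auto simp: b)
          then have "?J \<in> nbhds i" using A by (auto simp: nbhds_def ab a b indices_def)
          moreover have "k (j, p) = p ((\<lambda>n. h (2 * n)) \<circ> dilation i)" if "j \<in> ?J" "p \<in> ends" for j p
          proof -
            have "j \<in> core A B" using that False by (auto simp: core_def indices_def b)
            then show ?thesis using high[OF that(2)] by (simp add: k_def ab a b)
          qed
          ultimately show ?thesis using h2 by blast
        qed
      qed
    qed
    show "k (i, p) = p h" if "i \<in> core A B" "p \<in> ends" for i p
      using that by (simp add: k_def)
    show "\<exists>\<phi>. unit_seq \<phi> \<and> (\<forall>p\<in>ends. f (i, p) = p \<phi> \<and> k (i, p) = p (\<theta> \<circ> \<phi>))"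
      if "i \<in> indices - core A B" for i
      using code[OF that] that by (intro exI[of _ "code i"]) (auto simp: k_def)
  qed
qed

lemma continuous_map_plank_slow:
  assumes "slow g" "unit_seq g"
  shows "continuous_map plank (top_of_set {0..1}) (\<lambda>(i, p). p g)"
proof -
  have c: "continuous_map plank (top_of_set {0..1}) (\<lambda>_. 0 :: real)" by simp
  obtain k where k: "continuous_map plank (top_of_set {0..1}) k"
    "\<And>i p. i \<in> core {} {} \<Longrightarrow> p \<in> ends \<Longrightarrow> k (i, p) = p g"
    by (rule continuous_map_plank_piecewise[OF c countable_empty small_empty assms, of "\<lambda>x. x"]) auto
  have "core {} {} = indices" by (auto simp: core_def)
  with k show ?thesis
    by (auto simp: topspace_plank elim!: continuous_map_eq)
qed

section \<open>Compactifications\<close>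

text \<open>Points with disjoint neighbourhoods have different traces on the dense set. This bounds
  the size of a compactification by sets of subsets of \<open>S\<close>, so that it fits into a
  fixed type.\<close>

lemma inj_on_trace:
  assumes haus: "Hausdorff_space Y" and S: "e ` S \<subseteq> topspace Y" and dense: "Y closure_of (e ` S) = topspace Y"
  shows "inj_on (\<lambda>y. {U. U \<subseteq> S \<and> y \<in> Y closure_of (e ` U)}) (topspace Y)"
proof (rule inj_onI, rule ccontr)
  fix y z assume yz: "y \<in> topspace Y" "z \<in> topspace Y" "y \<noteq> z"
    and eq: "{U. U \<subseteq> S \<and> y \<in> Y closure_of (e ` U)} = {U. U \<subseteq> S \<and> z \<in> Y closure_of (e ` U)}"
  obtain V W where VW: "openin Y V" "openin Y W" "y \<in> V" "z \<in> W" "disjnt V W"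
    using haus yz unfolding Hausdorff_space_def by metis
  let ?U = "{s \<in> S. e s \<in> V}"
  have "V \<inter> e ` S = e ` ?U" by auto
  then have "y \<in> Y closure_of (e ` ?U)"
    using openin_Int_closure_of_subset[OF VW(1), of "e ` S"] VW(3) yz(1) by (auto simp: dense)
  then have "?U \<in> {U. U \<subseteq> S \<and> z \<in> Y closure_of (e ` U)}" unfolding eq[symmetric] by simp
  then have "z \<in> Y closure_of (e ` ?U)" by simp
  then obtain s where "e s \<in> V" "e s \<in> W" using VW(2,4) unfolding in_closure_of by blast
  with VW(5) show False by (auto simp: disjnt_def)
qed

lemma inj_on_plank_real_set: "\<exists>\<psi> :: index \<times> ((nat \<Rightarrow> real) \<Rightarrow> real) \<Rightarrow> real set. inj_on \<psi> (topspace plank)"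
proof -
  obtain c :: "real \<times> real \<Rightarrow> real" where c: "inj c" using inj_real_pair by blast
  obtain r :: "nat set \<Rightarrow> real" where r: "inj r"
    using nat_sets_eqpoll_reals unfolding eqpoll_def bij_betw_def by blast
  define t where "t q = {U. U \<subseteq> UNIV \<and> q \<in> bw closure_of (pt ` U)}" for q
  have t: "inj_on t ends"
    unfolding t_def using inj_on_trace[of bw pt UNIV] Hausdorff_space_Cech_Stone pt_in_bw dense_pt ends_subset
    by (metis (no_types, lifting) image_subsetI inj_on_subset)
  \<comment> \<open>Four tagged layers of a set of pairs of reals: the row, the column, a flag that
    tells \<open>None\<close> from \<open>Some {}\<close>, and the end, coded by the sets of
    integers in its trace.\<close>
  define w where "w = (\<lambda>((a :: real option, b :: real set option), q).
    {(0 :: real, x) |x. a = Some x} \<union> {(1, x) |x. \<exists>\<beta>. b = Some \<beta> \<and> x \<in> \<beta>} \<union>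
    {(2, 0) |x :: nat. b \<noteq> None} \<union> {(3, r U) |U. U \<in> t q})"
  have "inj_on w (topspace plank)"
  proof (rule inj_onI)
    fix x x' assume x: "x \<in> topspace plank" "x' \<in> topspace plank" and eq: "w x = w x'"
    obtain a b q a' b' q' where ab: "x = ((a, b), q)" "x' = ((a', b'), q')" by (metis prod.collapse)
    have 0: "(0, u) \<in> w x \<longleftrightarrow> a = Some u" "(0, u) \<in> w x' \<longleftrightarrow> a' = Some u" for u by (auto simp: w_def ab)
    have 1: "(1, u) \<in> w x \<longleftrightarrow> (\<exists>\<beta>. b = Some \<beta> \<and> u \<in> \<beta>)" "(1, u) \<in> w x' \<longleftrightarrow> (\<exists>\<beta>. b' = Some \<beta> \<and> u \<in> \<beta>)" for u
      by (auto simp: w_def ab)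
    have 2: "(2, 0) \<in> w x \<longleftrightarrow> b \<noteq> None" "(2, 0) \<in> w x' \<longleftrightarrow> b' \<noteq> None" by (auto simp: w_def ab)
    have 3: "(3, r U) \<in> w x \<longleftrightarrow> U \<in> t q" "(3, r U) \<in> w x' \<longleftrightarrow> U \<in> t q'" for U
      using r by (auto simp: w_def ab inj_eq)
    have "a = a'" using 0 eq by (metis option.exhaust)
    moreover have "b = b'"
    proof (cases "b = None")
      case True then show ?thesis using 2 eq by simp
    next
      case False
      then obtain \<beta> \<beta>' where \<beta>: "b = Some \<beta>" "b' = Some \<beta>'" using 2 eq by auto
      then have "\<beta> = \<beta>'" using 1 eq by auto
      with \<beta> show ?thesis by simp
    qed
    moreover have "t q = t q'" using 3 eq by auto
    then have "q = q'" using inj_onD[OF t] x by (auto simp: ab topspace_plank)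
    ultimately show "x = x'" by (simp add: ab)
  qed
  then have "inj_on ((`) c \<circ> w) (topspace plank)"
    using c by (intro comp_inj_on) (auto intro!: inj_onI simp: inj_image_eq_iff)
  then show ?thesis by blast
qed

lemma homeomorphic_copy:
  assumes "inj_on \<phi> (topspace X)"
  shows "\<exists>Y. homeomorphic_map X Y \<phi>"
proof -
  let ?g = "inv_into (topspace X) \<phi>"
  let ?Y = "pullback_topology (\<phi> ` topspace X) ?g X"
  have "continuous_map X ?Y \<phi>"
  proof (rule continuous_map_pullback')
    show "continuous_map X X (?g \<circ> \<phi>)"
      by (rule continuous_map_eq[OF continuous_map_id]) (simp add: assms)
  qed auto
  moreover have "continuous_map ?Y X ?g"
    using continuous_map_pullback[OF continuous_map_id, of _ ?g] by (simp add: id_def o_def)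
  ultimately have "homeomorphic_maps X ?Y \<phi> ?g"
    unfolding homeomorphic_maps_def
    by (auto simp: assms topspace_pullback_topology f_inv_into_f)
  then show ?thesis using homeomorphic_maps_map by blast
qed

lemma continuous_map_evaluation: "continuous_map X (Cech_Stone X) (evaluation X)"
proof -
  have "continuous_map X (unit_cube X) (evaluation X)"
    unfolding unit_cube_def continuous_map_componentwise
    by (auto simp: evaluation_def unit_functions_def intro: continuous_map_eq)
  then show ?thesis
    using evaluation_image_subset[of X] unfolding topspace_Cech_Stone
    by (simp add: Cech_Stone_def continuous_map_in_subtopology image_subset_iff_funcset)
qed

text \<open>The Cech-Stone compactification of the plank by its universal property, free of the type
  it lives on. The map \<open>e\<close> merges ends that an edge fibre does not separate, so it is
  no embedding.\<close>

locale plank_compactification =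
  fixes Y :: "'y topology" and e :: "index \<times> ((nat \<Rightarrow> real) \<Rightarrow> real) \<Rightarrow> 'y"
  assumes compact: "compact_space Y" and Hausdorff: "Hausdorff_space Y"
    and continuous: "continuous_map plank Y e"
    and dense: "Y closure_of (e ` topspace plank) = topspace Y"
    and extension: "continuous_map plank (top_of_set {0..1}) f \<Longrightarrow>
      \<exists>F. continuous_map Y (top_of_set {0..1::real}) F \<and> (\<forall>x\<in>topspace plank. F (e x) = f x)"

text \<open>\<open>\<psi>\<close> codes points of the plank by sets of reals; applied to traces,
  which are sets of sets of points, it yields the type \<open>real set set set\<close>.\<close>

lemma plank_compactification_exists: "\<exists>(Y :: real set set set topology) e. plank_compactification Y e"
proof -
  let ?C = "Cech_Stone plank" and ?e = "evaluation plank"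
  obtain \<psi> :: "index \<times> ((nat \<Rightarrow> real) \<Rightarrow> real) \<Rightarrow> real set" where \<psi>: "inj_on \<psi> (topspace plank)"
    using inj_on_plank_real_set by blast
  define t where "t y = {U. U \<subseteq> topspace plank \<and> y \<in> ?C closure_of (?e ` U)}" for y
  have t: "inj_on t (topspace ?C)"
    unfolding t_def
    by (rule inj_on_trace[OF Hausdorff_space_Cech_Stone evaluation_image_subset evaluation_dense])
  have "inj_on ((`) ((`) \<psi>)) (Pow (Pow (topspace plank)))"
    by (intro inj_on_image_Pow \<psi>)
  moreover have "t ` topspace ?C \<subseteq> Pow (Pow (topspace plank))" by (auto simp: t_def)
  ultimately have "inj_on ((`) ((`) \<psi>) \<circ> t) (topspace ?C)"
    by (intro comp_inj_on[OF t]) (rule inj_on_subset)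
  then obtain Y \<phi> where \<phi>: "homeomorphic_map ?C (Y :: real set set set topology) \<phi>"
    using homeomorphic_copy by blast
  then obtain \<gamma> where \<gamma>: "homeomorphic_maps ?C Y \<phi> \<gamma>" using homeomorphic_map_maps by blast
  have "plank_compactification Y (\<phi> \<circ> ?e)"
  proof
    have "?C homeomorphic_space Y" using \<phi> by (rule homeomorphic_map_imp_homeomorphic_space)
    then show "compact_space Y"
      using compact_space_Cech_Stone homeomorphic_compact_space by blast
    show "Hausdorff_space Y"
      using \<open>?C homeomorphic_space Y\<close> Hausdorff_space_Cech_Stone homeomorphic_Hausdorff_space by blast
    show "continuous_map plank Y (\<phi> \<circ> ?e)"
      using \<gamma> by (intro continuous_map_compose[OF continuous_map_evaluation]) (simp add: homeomorphic_maps_def)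
    have "\<phi> ` (?C closure_of (?e ` topspace plank)) = Y closure_of (\<phi> ` ?e ` topspace plank)"
      using homeomorphic_map_closure_of[OF \<phi> evaluation_image_subset] by simp
    then show "Y closure_of ((\<phi> \<circ> ?e) ` topspace plank) = topspace Y"
      using homeomorphic_imp_surjective_map[OF \<phi>] by (simp add: evaluation_dense image_comp)
  next
    fix f :: "_ \<Rightarrow> real" assume "continuous_map plank (top_of_set {0..1}) f"
    then obtain g where g: "continuous_map ?C (top_of_set {0..1}) g" "\<And>x. x \<in> topspace plank \<Longrightarrow> g (?e x) = f x"
      using Cech_Stone_extension by metis
    show "\<exists>F. continuous_map Y (top_of_set {0..1}) F \<and> (\<forall>x\<in>topspace plank. F ((\<phi> \<circ> ?e) x) = f x)"
    proof (intro exI[of _ "g \<circ> \<gamma>"] conjI ballI)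
      show "continuous_map Y (top_of_set {0..1}) (g \<circ> \<gamma>)"
        using \<gamma> g by (auto simp: homeomorphic_maps_def intro: continuous_map_compose)
      fix x assume x: "x \<in> topspace plank"
      then have "\<gamma> (\<phi> (?e x)) = ?e x"
        using \<gamma> evaluation_image_subset[of plank] unfolding homeomorphic_maps_def by blast
      then show "(g \<circ> \<gamma>) ((\<phi> \<circ> ?e) x) = f x" using g(2)[OF x] by simp
    qed
  qed
  then show ?thesis by blast
qed

section \<open>Recognising a Cech-Stone compactification\<close>

lemma compact_Hausdorff_Urysohn:
  assumes "compact_space Y" "Hausdorff_space Y" "closedin Y S" "closedin Y T" "disjnt S T"
  shows "\<exists>f :: _ \<Rightarrow> real. continuous_map Y (top_of_set {0..1}) f \<and> f ` S \<subseteq> {0} \<and> f ` T \<subseteq> {1}"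
proof -
  have "normal_space Y"
    using assms by (intro compact_Hausdorff_or_regular_imp_normal_space) auto
  then show ?thesis using assms(3-5) unfolding normal_space_iff_Urysohn by blast
qed

text \<open>Uniqueness of the compactification. Extensions of the unit functions serve as cube
  coordinates of \<open>H\<close>; they separate points because a Urysohn function is the unique
  extension of its own restriction to \<open>S\<close>.\<close>

lemma Cech_Stone_homeomorphic_map:
  assumes compact: "compact_space Y" and Hausdorff: "Hausdorff_space Y" and S: "S \<subseteq> topspace Y"
    and dense: "Y closure_of S = topspace Y"
    and extension: "\<And>f. continuous_map (subtopology Y S) (top_of_set {0..1}) f \<Longrightarrow>
      \<exists>F. continuous_map Y (top_of_set {0..1::real}) F \<and> (\<forall>x\<in>S. F x = f x)"
  shows "\<exists>H. homeomorphic_map Y (Cech_Stone (subtopology Y S)) H \<and>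
    (\<forall>x\<in>S. H x = evaluation (subtopology Y S) x)"
proof -
  let ?Z = "subtopology Y S"
  let ?U = "unit_functions ?Z"
  have tZ: "topspace ?Z = S" using S by auto
  have "\<forall>f\<in>?U. \<exists>F. continuous_map Y (top_of_set {0..1::real}) F \<and> (\<forall>x\<in>S. F x = f x)"
    using extension by (auto simp: unit_functions_def)
  then obtain E where E: "\<And>f. f \<in> ?U \<Longrightarrow> continuous_map Y (top_of_set {0..1}) (E f)"
    "\<And>f x. f \<in> ?U \<Longrightarrow> x \<in> S \<Longrightarrow> E f x = f x" by metis
  define H where "H y = (\<lambda>f\<in>?U. E f y)" for y
  have HS: "H x = evaluation ?Z x" if "x \<in> S" for x
    using E(2) that by (auto simp: H_def evaluation_def)
  have cube: "continuous_map Y (unit_cube ?Z) H"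
    unfolding unit_cube_def continuous_map_componentwise
  proof (intro conjI ballI)
    show "H ` topspace Y \<subseteq> extensional ?U" by (auto simp: H_def)
    show "continuous_map Y (top_of_set {0..1}) (\<lambda>x. H x f)" if "f \<in> ?U" for f
      using E(1)[OF that] that by (simp add: H_def)
  qed
  have image: "H ` S = evaluation ?Z ` topspace ?Z"
    using HS unfolding tZ by (rule image_cong[OF refl])
  have "H ` topspace Y \<subseteq> topspace (Cech_Stone ?Z)"
    using continuous_map_image_closure_subset[OF cube, of S]
    by (simp add: dense topspace_Cech_Stone image)
  then have cont: "continuous_map Y (Cech_Stone ?Z) H"
    using cube unfolding Cech_Stone_def topspace_Cech_Stone[unfolded Cech_Stone_def]
    by (auto simp: continuous_map_in_subtopology)
  have inj: "inj_on H (topspace Y)"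
  proof (rule inj_onI, rule ccontr)
    fix y z assume yz: "y \<in> topspace Y" "z \<in> topspace Y" "H y = H z" "y \<noteq> z"
    have "closedin Y {y}" "closedin Y {z}" "disjnt {y} {z}"
      using yz closedin_Hausdorff_singleton[OF Hausdorff] by (auto simp: disjnt_def)
    from compact_Hausdorff_Urysohn[OF compact Hausdorff this]
    obtain F :: "_ \<Rightarrow> real" where F: "continuous_map Y (top_of_set {0..1}) F" "F y = 0" "F z = 1"
      by auto
    let ?f = "restrict F S"
    have f: "?f \<in> ?U"
      using continuous_map_from_subtopology[OF F(1), of S] S
      by (auto simp: unit_functions_def Int_absorb1 elim!: continuous_map_eq)
    have EF: "E ?f y = F y" if "y \<in> topspace Y" for y
    proof -
      have "continuous_map Y euclideanreal (\<lambda>y. E ?f y - F y)"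
        using E(1)[OF f] F(1) by (intro continuous_map_diff) (auto simp: continuous_map_in_subtopology)
      then have "E ?f y - F y \<in> {0}"
        by (rule closure_of_value[where S = S]) (use that dense E(2)[OF f] in auto)
      then show ?thesis by simp
    qed
    have "H x ?f = E ?f x" for x using f by (simp add: H_def)
    then have "E ?f y = E ?f z" using yz(3) by metis
    then show False using EF yz(1,2) F(2,3) by simp
  qed
  have "closedin (Cech_Stone ?Z) (H ` topspace Y)"
    using compact by (intro compactin_imp_closedin Hausdorff_space_Cech_Stone image_compactin[OF _ cont])
      (simp add: compact_space_def)
  then have "Cech_Stone ?Z closure_of (evaluation ?Z ` topspace ?Z) \<subseteq> H ` topspace Y"
    using S by (intro closure_of_minimal) (simp_all only: image[symmetric] image_mono)
  then have "H ` topspace Y = topspace (Cech_Stone ?Z)"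
    using continuous_map_image_subset_topspace[OF cont] unfolding evaluation_dense by blast
  then have "homeomorphic_map Y (Cech_Stone ?Z) H"
    by (intro continuous_imp_homeomorphic_map[OF cont compact Hausdorff_space_Cech_Stone _ inj])
  with HS show ?thesis by blast
qed

lemma homeomorphic_continuum:
  "X homeomorphic_space Y \<Longrightarrow> continuum X \<longleftrightarrow> continuum Y"
  by (simp add: continuum_def homeomorphic_connected_space homeomorphic_compact_space homeomorphic_Hausdorff_space)

lemma homeomorphic_indecomposable_continuum:
  assumes hom: "X homeomorphic_space Y" and X: "indecomposable_continuum X"
  shows "indecomposable_continuum Y"
  unfolding indecomposable_continuum_def
proof (intro conjI notI)
  show "continuum Y" using X homeomorphic_continuum[OF hom] by (simp add: indecomposable_continuum_def)
  assume "\<exists>A B. A \<subset> topspace Y \<and> continuum (subtopology Y A) \<and>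
              B \<subset> topspace Y \<and> continuum (subtopology Y B) \<and> topspace Y = A \<union> B"
  then obtain A B where AB: "A \<subset> topspace Y" "continuum (subtopology Y A)"
    "B \<subset> topspace Y" "continuum (subtopology Y B)" "topspace Y = A \<union> B" by blast
  obtain g where g: "homeomorphic_map Y X g"
    using hom homeomorphic_space_sym homeomorphic_space by blast
  have inj: "inj_on g (topspace Y)" and sur: "g ` topspace Y = topspace X"
    using g homeomorphic_imp_injective_map homeomorphic_imp_surjective_map by blast+
  have sub: "g ` C \<subset> topspace X \<and> continuum (subtopology X (g ` C))"
    if C: "C \<subset> topspace Y" "continuum (subtopology Y C)" for C
  proof
    show "g ` C \<subset> topspace X"
      using C(1) inj_on_image_eq_iff[OF inj, of C "topspace Y"] unfolding sur[symmetric] by blast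
    have "homeomorphic_map (subtopology Y C) (subtopology X (g ` C)) g"
      using C(1) inj sur
      by (intro homeomorphic_map_subtopologies[OF g]) (auto simp: inj_on_eq_iff)
    then show "continuum (subtopology X (g ` C))"
      using C(2) homeomorphic_continuum homeomorphic_map_imp_homeomorphic_space by blast
  qed
  have "topspace X = g ` A \<union> g ` B" using sur AB(5) by (metis image_Un)
  with sub[OF AB(1,2)] sub[OF AB(3,4)] X show False
    unfolding indecomposable_continuum_def by blast
qed

section \<open>The corner continuum\<close>

context plank_compactification
begin

lemma Urysohn:
  assumes "closedin Y S" "closedin Y T" "S \<inter> T = {}"
  obtains F :: "'y \<Rightarrow> real" where "continuous_map Y (top_of_set {0..1}) F"
    "\<And>y. y \<in> S \<Longrightarrow> F y = 0" "\<And>y. y \<in> T \<Longrightarrow> F y = 1"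
proof -
  obtain F :: "'y \<Rightarrow> real" where "continuous_map Y (top_of_set {0..1}) F" "F ` S \<subseteq> {0}" "F ` T \<subseteq> {1}"
    using compact_Hausdorff_Urysohn[OF compact Hausdorff assms(1,2)] assms(3) by (auto simp: disjnt_def)
  then show thesis using that by blast
qed

lemma e_in_Y: "i \<in> indices \<Longrightarrow> p \<in> ends \<Longrightarrow> e (i, p) \<in> topspace Y"
  using continuous_map_image_subset_topspace[OF continuous] by (auto simp: topspace_plank)

lemma to_real: "continuous_map Y (top_of_set {0..1}) F \<Longrightarrow> continuous_map Y euclideanreal F" for F :: "'y \<Rightarrow> real"
  by (simp add: continuous_map_in_subtopology)

definition core_closure :: "real set \<Rightarrow> real set set \<Rightarrow> 'y set" where
  "core_closure A B = Y closure_of (e ` (core A B \<times> ends))"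

text \<open>The cluster set in \<open>Y\<close> of the plank as the index tends to the missing
  corner.\<close>

definition corner :: "'y set" where
  "corner = \<Inter>{core_closure A B |A B. countable A \<and> small B}"

lemma corner_subset: "countable A \<Longrightarrow> small B \<Longrightarrow> corner \<subseteq> core_closure A B"
  by (auto simp: corner_def)

lemma corner_subset_Y: "corner \<subseteq> topspace Y"
  using corner_subset[OF countable_empty small_empty] closure_of_subset_topspace
  unfolding core_closure_def by fast

lemma closedin_corner: "closedin Y corner"
  unfolding corner_def
proof (rule closedin_Inter)
  show "{core_closure A B |A B. countable A \<and> small B} \<noteq> {}" using small_empty by blast
qed (auto simp: core_closure_def)

text \<open>\<open>g\<close> is the germ of \<open>F\<close> at the corner, determined modulo
  c_0.\<close>

definition code :: "('y \<Rightarrow> real) \<Rightarrow> (nat \<Rightarrow> real) \<Rightarrow> bool" where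
  "code F g \<longleftrightarrow> continuous_map Y (top_of_set {0..1}) F \<and> slow g \<and> unit_seq g \<and>
     (\<exists>A B. countable A \<and> small B \<and> (\<forall>i\<in>core A B. \<forall>p\<in>ends. F (e (i, p)) = p g))"

lemma codeD:
  assumes "code F g"
  shows "continuous_map Y (top_of_set {0..1}) F" "slow g" "unit_seq g"
  using assms by (auto simp: code_def)

lemma code_exists:
  assumes "continuous_map Y (top_of_set {0..1}) F"
  obtains g where "code F g"
proof -
  have "continuous_map plank (top_of_set {0..1}) (F \<circ> e)"
    by (rule continuous_map_compose[OF continuous assms])
  then obtain g A B where "slow g" "unit_seq g" "countable A" "small B"
    "\<And>i p. i \<in> core A B \<Longrightarrow> p \<in> ends \<Longrightarrow> (F \<circ> e) (i, p) = p g"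
    using continuous_map_plank_core by metis
  then have "code F g" using assms unfolding code_def comp_apply by blast
  then show thesis by (rule that)
qed

lemma function_with_code:
  assumes "slow g" "unit_seq g"
  obtains F where "code F g"
proof -
  obtain F where "continuous_map Y (top_of_set {0..1}) F"
    "\<And>x. x \<in> topspace plank \<Longrightarrow> F (e x) = (\<lambda>(i, p). p g) x"
    using extension[OF continuous_map_plank_slow[OF assms]] by blast
  moreover have "core {} {} = indices" by (auto simp: core_def)
  ultimately have "code F g"
    using assms small_empty unfolding code_def
    by (intro conjI exI[of _ "{}"]) (auto simp: topspace_plank)
  then show thesis by (rule that)
qed

lemma corner_value:
  assumes \<Psi>: "continuous_map Y euclideanreal \<Psi>" and T: "closed T" and "countable A" "small B"
    and val: "\<And>i p. i \<in> core A B \<Longrightarrow> p \<in> ends \<Longrightarrow> \<Psi> (e (i, p)) \<in> T" and y: "y \<in> corner"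
  shows "\<Psi> y \<in> T"
proof (rule closure_of_value[OF \<Psi> T])
  show "y \<in> Y closure_of (e ` (core A B \<times> ends))"
    using corner_subset[OF assms(3,4)] y by (auto simp: core_closure_def)
qed (use val in auto)

lemma corner_value_code:
  assumes F: "code F g" and T: "closed T" "\<forall>\<^sub>F n in sequentially. g n \<in> T" and y: "y \<in> corner"
  shows "F y \<in> T"
proof -
  obtain A B where AB: "countable A" "small B" "\<And>i p. i \<in> core A B \<Longrightarrow> p \<in> ends \<Longrightarrow> F (e (i, p)) = p g"
    using F unfolding code_def by blast
  have pg: "p g \<in> T" if "p \<in> ends" for p
    using codeD[OF F] T that by (intro ends_value[OF continuous_map_value(2) T(1)]) (auto simp: pt_apply)
  show ?thesis
    by (rule corner_value[OF to_real[OF codeD(1)[OF F]] T(1) AB(1,2) _ y]) (simp add: AB(3) pg)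
qed

lemma core_antimono: "core (A \<union> A') (B \<union> B') = core A B \<inter> core A' B'"
  by (auto simp: core_def)

lemma core_nonempty:
  assumes "countable A" "small B"
  shows "core A B \<noteq> {}"
proof -
  obtain a b where "a \<notin> A" "b \<notin> B" using uncountable_avoid small_avoid assms by metis
  then have "(Some a, Some b) \<in> core A B" by (auto simp: core_def indices_def)
  then show ?thesis by blast
qed

text \<open>A cluster point of \<open>e (i, q)\<close> as \<open>i\<close> tends to the corner. The
  closures \<open>C A B\<close> are directed and nonempty, so compactness supplies it, and it
  evaluates codes at \<open>q\<close>.\<close>

lemma corner_point:
  assumes q: "q \<in> ends"
  obtains y where "y \<in> corner" "\<And>F g. code F g \<Longrightarrow> F y = q g"
proof -
  define C where "C A B = Y closure_of (e ` (core A B \<times> {q}))" for A B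
  let ?\<C> = "{C A B |A B. countable A \<and> small B}"
  have directed: "\<exists>A B. countable A \<and> small B \<and> C A B \<subseteq> \<Inter>\<F>" if "finite \<F>" "\<F> \<subseteq> ?\<C>" for \<F>
    using that
  proof (induction \<F> rule: finite_induct)
    case empty show ?case using small_empty by (intro exI[of _ "{}"]) auto
  next
    case (insert D \<F>)
    then obtain A B A' B' where AB: "countable A" "small B" "C A B \<subseteq> \<Inter>\<F>"
      "countable A'" "small B'" "D = C A' B'" by auto
    have "C (A \<union> A') (B \<union> B') \<subseteq> C A B" "C (A \<union> A') (B \<union> B') \<subseteq> C A' B'"
      unfolding C_def core_antimono by (intro closure_of_mono; blast)+
    then show ?case using AB by (intro exI[of _ "A \<union> A'"] exI[of _ "B \<union> B'"]) (auto simp: small_Un)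
  qed
  have nonempty: "C A B \<noteq> {}" if AB: "countable A" "small B" for A B
  proof -
    obtain i where "i \<in> core A B" using core_nonempty[OF AB] by blast
    then have "e (i, q) \<in> C A B"
      unfolding C_def using e_in_Y[OF _ q] core_subset[of A B]
      by (intro subsetD[OF closure_of_subset]) auto
    then show ?thesis by blast
  qed
  have "\<Inter>\<F> \<noteq> {}" if "finite \<F>" "\<F> \<subseteq> ?\<C>" for \<F>
  proof -
    from directed[OF that] obtain A B where "countable A" "small B" "C A B \<subseteq> \<Inter>\<F>" by blast
    with nonempty show ?thesis by blast
  qed
  moreover have "closedin Y D" if "D \<in> ?\<C>" for D using that by (auto simp: C_def)
  ultimately have "\<Inter>?\<C> \<noteq> {}"
    using compact[unfolded compact_space_fip, THEN spec, of ?\<C>] by (meson ballI)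
  then obtain y where y: "\<And>A B. countable A \<Longrightarrow> small B \<Longrightarrow> y \<in> C A B" by blast
  show thesis
  proof
    have "C A B \<subseteq> core_closure A B" for A B
      unfolding C_def core_closure_def using q by (intro closure_of_mono) blast
    then show "y \<in> corner" unfolding corner_def using y by blast
    fix F g assume F: "code F g"
    then obtain A B where AB: "countable A" "small B" "\<And>i p. i \<in> core A B \<Longrightarrow> p \<in> ends \<Longrightarrow> F (e (i, p)) = p g"
      unfolding code_def by blast
    have "F y \<in> {q g}"
      by (rule closure_of_value[OF to_real[OF codeD(1)[OF F]] _ _ y[OF AB(1,2), unfolded C_def]])
         (use AB(3) q in auto)
    then show "F y = q g" by simp
  qed
qed

lemma corner_function_limit:
  assumes F: "code F g" and lim: "g \<longlonglongrightarrow> c" and y: "y \<in> corner"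
  shows "F y = c"
proof -
  obtain A B where AB: "countable A" "small B" "\<And>i p. i \<in> core A B \<Longrightarrow> p \<in> ends \<Longrightarrow> F (e (i, p)) = p g"
    using F unfolding code_def by blast
  have "F y \<in> {c}"
    by (rule corner_value[OF to_real[OF codeD(1)[OF F]] _ AB(1,2) _ y])
       (use AB(3) ends_value_limit[OF codeD(3)[OF F] lim] in auto)
  then show ?thesis by simp
qed

text \<open>Every end is realised in the corner, so \<open>g n * (1 - g n)\<close> vanishes at all
  ends and tends to 0.\<close>

lemma corner_two_valued_constant:
  fixes F :: "'y \<Rightarrow> real"
  assumes F: "continuous_map Y (top_of_set {0..1}) F" and two: "\<And>y. y \<in> corner \<Longrightarrow> F y = 0 \<or> F y = 1"
  shows "(\<forall>y\<in>corner. F y = 0) \<or> (\<forall>y\<in>corner. F y = 1)"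
proof -
  obtain g where g: "code F g" using code_exists[OF F] .
  note g' = codeD[OF g]
  have "(\<lambda>n. g n * (1 - g n)) \<longlonglongrightarrow> 0"
  proof (rule ends_eq_limit)
    show "unit_seq (\<lambda>n. g n * (1 - g n))" by (intro unit_seq_mult unit_seq_compl g')
    fix q assume q: "q \<in> ends"
    obtain y where "y \<in> corner" "F y = q g" using corner_point[OF q] g by metis
    moreover have "q (\<lambda>n. g n * (1 - g n)) = q g * (1 - q g)"
      using ends_mult[OF g'(3) unit_seq_compl[OF g'(3)] q] ends_compl[OF g'(3) q] by simp
    ultimately show "q (\<lambda>n. g n * (1 - g n)) = 0"
      using two[of y] by auto
  qed
  then have "g \<longlonglongrightarrow> 0 \<or> g \<longlonglongrightarrow> 1" by (rule slow_two_valued_limit[OF g'(2,3)])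
  then show ?thesis using corner_function_limit[OF g] by blast
qed

lemma topspace_corner: "topspace (subtopology Y corner) = corner"
  using corner_subset_Y by auto

lemma continuum_corner: "continuum (subtopology Y corner)"
  unfolding continuum_def
proof (intro conjI)
  show "compact_space (subtopology Y corner)"
    using closedin_compact_space[OF compact closedin_corner] by (rule compact_space_subtopology)
  show "Hausdorff_space (subtopology Y corner)" by (rule Hausdorff_space_subtopology[OF Hausdorff])
  show "connected_space (subtopology Y corner)"
    unfolding connected_space_closedin
  proof (intro notI, elim exE conjE)
    fix S T
    assume ST: "closedin (subtopology Y corner) S" "closedin (subtopology Y corner) T"
      "topspace (subtopology Y corner) \<subseteq> S \<union> T" "S \<inter> T = {}" "S \<noteq> {}" "T \<noteq> {}"
    have sub: "S \<subseteq> corner" "T \<subseteq> corner" using ST(1,2) closedin_subset topspace_corner by metis+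
    have "closedin Y S" "closedin Y T"
      using ST(1,2) closedin_closed_subtopology[OF closedin_corner] by auto
    then obtain F :: "'y \<Rightarrow> real" where F: "continuous_map Y (top_of_set {0..1}) F"
      "\<And>y. y \<in> S \<Longrightarrow> F y = 0" "\<And>y. y \<in> T \<Longrightarrow> F y = 1"
      using Urysohn ST(4) by metis
    have "F y = 0 \<or> F y = 1" if "y \<in> corner" for y using that ST(3) F topspace_corner by blast
    from corner_two_valued_constant[OF F(1) this] show False
      using F(2,3) ST(5,6) sub by fastforce
  qed
qed

text \<open>In a one-point corner every code would have equal values at all ends and so
  converge.\<close>

lemma corner_nontrivial: "\<exists>y\<in>corner. \<exists>z\<in>corner. y \<noteq> z"
proof (rule ccontr)
  assume single: "\<not> ?thesis"
  obtain g where g: "slow g" "unit_seq g" "\<not> convergent g" by (rule slow_nonconvergent)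
  obtain F where F: "code F g" using function_with_code[OF g(1,2)] .
  have "infinite (UNIV :: nat set)" by simp
  then obtain q0 where q0: "q0 \<in> ends" using ends_accumulate by metis
  then obtain y0 where y0: "y0 \<in> corner" using corner_point by metis
  have "q g = F y0" if "q \<in> ends" for q
    using corner_point[OF that] F single y0 by metis
  then have "g \<longlonglongrightarrow> F y0" by (rule ends_eq_limit[OF g(2)])
  with g(3) show False by (auto simp: convergent_def)
qed

section \<open>Indecomposability of the corner\<close>

lemma frequently_large:
  assumes F: "code F f" and y: "y \<in> corner" "F y = 1"
  shows "infinite {n. f n \<ge> 2/3}"
proof
  assume "finite {n. f n \<ge> 2/3}"
  then have "\<forall>\<^sub>F n in sequentially. \<not> f n \<ge> 2/3"
    by (simp add: cofinite_eq_sequentially[symmetric] eventually_cofinite)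
  then have "\<forall>\<^sub>F n in sequentially. f n \<in> {..2/3}" by (rule eventually_mono) auto
  from corner_value_code[OF F _ this y(1)] y(2) show False by simp
qed

text \<open>If \<open>A\<close> and \<open>B\<close> are proper subcontinua that cover the corner, take \<open>F\<close> vanishing on \<open>B\<close> and \<open>G\<close>
  vanishing on \<open>A\<close>: alternating between their supports yields an \<open>H\<close> that disconnects \<open>A\<close>.\<close>

lemma corner_alternating:
  assumes F: "code F f" and G: "code G g" and prod: "\<And>y. y \<in> corner \<Longrightarrow> F y * G y = 0"
    and x: "x \<in> corner" "F x = 1" and y: "y \<in> corner" "G y = 1"
  obtains H :: "'y \<Rightarrow> real" where "continuous_map Y (top_of_set {0..1}) H"
    "\<And>z. z \<in> corner \<Longrightarrow> G z = 0 \<Longrightarrow> H z = 0 \<or> H z = 1"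
    "\<exists>z\<in>corner. F z \<noteq> 0 \<and> H z = 0" "\<exists>z\<in>corner. F z \<noteq> 0 \<and> H z = 1"
proof -
  note f' = codeD[OF F] and g' = codeD[OF G]
  have fg: "(\<lambda>n. f n * g n) \<longlonglongrightarrow> 0"
  proof (rule ends_eq_limit[OF unit_seq_mult[OF f'(3) g'(3)]])
    fix q assume q: "q \<in> ends"
    obtain z where z: "z \<in> corner" "\<And>F g. code F g \<Longrightarrow> F z = q g" using corner_point[OF q] by blast
    show "q (\<lambda>n. f n * g n) = 0"
      using prod[OF z(1)] z(2)[OF F] z(2)[OF G] by (simp add: ends_mult f' g' q)
  qed
  \<comment> \<open>Where \<open>f n \<ge> 2/3\<close> but \<open>g n > 1/3\<close> the product is
    at least 2/9, which happens only finitely often.\<close>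
  define N where "N = {n. f n \<ge> 2/3 \<and> g n \<le> 1/3}"
  have "\<forall>\<^sub>F n in sequentially. f n * g n < 2/9"
    using order_tendstoD(2)[OF fg, of "2/9"] by simp
  then have "finite {n. \<not> f n * g n < 2/9}"
    by (simp add: cofinite_eq_sequentially[symmetric] eventually_cofinite)
  moreover have "{n. f n \<ge> 2/3} \<subseteq> N \<union> {n. \<not> f n * g n < 2/9}"
  proof
    fix n assume n: "n \<in> {n. f n \<ge> 2/3}"
    have "f n * g n \<ge> 2/3 * (1/3)" if "g n > 1/3"
      using n that by (intro mult_mono) auto
    then show "n \<in> N \<union> {n. \<not> f n * g n < 2/9}" using n by (force simp: N_def)
  qed
  ultimately have "infinite N" using frequently_large[OF F x] finite_subset by blast
  moreover have "g n \<le> 1/3" if "n \<in> N" for n using that by (simp add: N_def)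
  moreover note frequently_large[OF G y]
  ultimately obtain h where h: "slow h" "unit_seq h" "\<And>n. g n \<le> 1/3 \<Longrightarrow> h n = 0 \<or> h n = 1"
    "infinite {n\<in>N. h n = 0}" "infinite {n\<in>N. h n = 1}"
    using slow_flip[OF g'(2,3), of "{n. g n \<ge> 2/3}" N] by blast
  obtain H where H: "code H h" using function_with_code[OF h(1,2)] .
  note H' = codeD[OF H]
  \<comment> \<open>An end accumulating on these integers has \<open>f\<close>-value at least 2/3
    and \<open>h\<close>-value \<open>c\<close>, and is realised by a point of the corner.\<close>
  have hits: "\<exists>z\<in>corner. F z \<noteq> 0 \<and> H z = c" if inf: "infinite {n\<in>N. h n = c}" for c
  proof -
    obtain q where q: "q \<in> ends" "q \<in> bw closure_of (pt ` {n\<in>N. h n = c})"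
      using ends_accumulate[OF inf] .
    have "q f \<in> {2/3..}"
      by (rule closure_of_value[OF continuous_map_value(2)[OF f'(3)] _ _ q(2)])
         (auto simp: pt_apply f' N_def)
    moreover have "q h \<in> {c}"
      by (rule closure_of_value[OF continuous_map_value(2)[OF h(2)] _ _ q(2)]) (auto simp: pt_apply h)
    moreover obtain z where "z \<in> corner" "\<And>F g. code F g \<Longrightarrow> F z = q g" using corner_point[OF q(1)] by blast
    ultimately show ?thesis using F H by (intro bexI[of _ z]) auto
  qed
  obtain A B where AB: "countable A" "small B" "\<And>i p. i \<in> core A B \<Longrightarrow> p \<in> ends \<Longrightarrow> G (e (i, p)) = p g"
    using G unfolding code_def by blast
  obtain A' B' where AB': "countable A'" "small B'" "\<And>i p. i \<in> core A' B' \<Longrightarrow> p \<in> ends \<Longrightarrow> H (e (i, p)) = p h"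
    using H unfolding code_def by blast
  \<comment> \<open>The same expression in \<open>g n\<close> and \<open>h n\<close> is zero, since
    \<open>h n\<close> is 0 or 1 whenever \<open>g n \<le> 1/3\<close>. Where \<open>G z = 0\<close>
    the first factor is 1/3, so \<open>H z\<close> is 0 or 1.\<close>
  define \<Psi> where "\<Psi> z = max 0 (1/3 - G z) * (H z * (1 - H z))" for z
  have \<Psi>: "continuous_map Y euclideanreal \<Psi>"
    unfolding \<Psi>_def using to_real[OF g'(1)] to_real[OF H'(1)]
    by (intro continuous_map_real_mult continuous_map_real_max continuous_map_diff) auto
  have \<Psi>0: "\<Psi> z = 0" if "z \<in> corner" for z
  proof -
    have "max 0 (1/3 - p g) * (p h * (1 - p h)) = 0" if "p \<in> ends" for p
    proof (rule ends_value_identity[OF _ _ that])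
      show "continuous_map bw euclideanreal (\<lambda>p. max 0 (1/3 - p g) * (p h * (1 - p h)))"
        by (intro continuous_map_real_mult continuous_map_real_max continuous_map_diff
            continuous_map_value g' h) auto
      show "max 0 (1/3 - pt n g) * (pt n h * (1 - pt n h)) = 0" for n
        using h(3)[of n] by (cases "g n \<le> 1/3") (auto simp: pt_apply g' h)
    qed
    then have "\<Psi> (e (i, p)) \<in> {0}" if "i \<in> core (A \<union> A') (B \<union> B')" "p \<in> ends" for i p
      using that AB(3) AB'(3) by (simp add: core_antimono \<Psi>_def)
    then have "\<Psi> z \<in> {0}"
      using AB AB' that by (intro corner_value[OF \<Psi> _ _ _ _ that, of _ "A \<union> A'" "B \<union> B'"]) (auto simp: small_Un)
    then show ?thesis by simp
  qed
  show thesis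
  proof (rule that[OF H'(1) _ hits[OF h(4)] hits[OF h(5)]])
    fix z assume "z \<in> corner" "G z = 0"
    then show "H z = 0 \<or> H z = 1" using \<Psi>0[of z] by (simp add: \<Psi>_def)
  qed
qed

lemma indecomposable_corner: "indecomposable_continuum (subtopology Y corner)"
  unfolding indecomposable_continuum_def topspace_corner
proof (intro conjI notI continuum_corner)
  assume "\<exists>A B. A \<subset> corner \<and> continuum (subtopology (subtopology Y corner) A) \<and>
    B \<subset> corner \<and> continuum (subtopology (subtopology Y corner) B) \<and> corner = A \<union> B"
  then obtain A B where AB: "A \<subset> corner" "B \<subset> corner" "corner = A \<union> B"
    and cont: "continuum (subtopology (subtopology Y corner) A)" "continuum (subtopology (subtopology Y corner) B)"
    by blast
  have sub: "subtopology (subtopology Y corner) A = subtopology Y A" "subtopology (subtopology Y corner) B = subtopology Y B"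
    using AB by (simp_all add: subtopology_subtopology inf.absorb2 psubset_imp_subset)
  have "compactin Y A" "compactin Y B"
    using cont AB(1,2) corner_subset_Y unfolding sub continuum_def compactin_subspace by blast+
  then have closed: "closedin Y A" "closedin Y B"
    using compactin_imp_closedin[OF Hausdorff] by auto
  obtain x y where x: "x \<in> corner" "x \<notin> B" and y: "y \<in> corner" "y \<notin> A" using AB(1,2) by blast
  have "closedin Y {x}" "closedin Y {y}"
    using x y corner_subset_Y by (auto intro!: closedin_Hausdorff_singleton Hausdorff)
  then obtain F G :: "'y \<Rightarrow> real"
    where F: "continuous_map Y (top_of_set {0..1}) F" "\<And>z. z \<in> B \<Longrightarrow> F z = 0" "F x = 1"
      and G: "continuous_map Y (top_of_set {0..1}) G" "\<And>z. z \<in> A \<Longrightarrow> G z = 0" "G y = 1"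
    using Urysohn[OF closed(2) \<open>closedin Y {x}\<close>] Urysohn[OF closed(1) \<open>closedin Y {y}\<close>] x(2) y(2)
    by (metis Int_insert_right_if0 Int_empty_right singletonI)
  obtain f where f: "code F f" using code_exists[OF F(1)] .
  obtain g where g: "code G g" using code_exists[OF G(1)] .
  have "F z * G z = 0" if "z \<in> corner" for z using that AB(3) F(2) G(2) by auto
  then obtain H :: "'y \<Rightarrow> real" where H: "continuous_map Y (top_of_set {0..1}) H"
    "\<And>z. z \<in> corner \<Longrightarrow> G z = 0 \<Longrightarrow> H z = 0 \<or> H z = 1"
    "\<exists>z\<in>corner. F z \<noteq> 0 \<and> H z = 0" "\<exists>z\<in>corner. F z \<noteq> 0 \<and> H z = 1"
    using corner_alternating[OF f g _ x(1) F(3) y(1) G(3)] by blast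
  have "connectedin Y A"
    using cont(1) AB(1) corner_subset_Y unfolding sub continuum_def connectedin_def by blast
  then have "connected (H ` A)"
    using connectedin_continuous_map_image[OF to_real[OF H(1)]] by simp
  \<comment> \<open>Where \<open>F\<close> is nonzero the point lies outside \<open>B\<close>, hence
    in \<open>A\<close>; so \<open>H\<close> takes both values on \<open>A\<close>, and only these,
    as \<open>G\<close> vanishes there.\<close>
  moreover have "0 \<in> H ` A" "1 \<in> H ` A"
    using H(3,4) AB(3) F(2) by (metis Un_iff image_eqI)+
  ultimately have "1/2 \<in> H ` A" by (rule connectedD_interval) auto
  then show False using H(2) G(2) AB(3) by fastforce
qed

subsection \<open>The complement of the corner\<close>

definition Z :: "'y topology" where
  "Z = subtopology Y (topspace Y - corner)"

lemma topspace_Z: "topspace Z = topspace Y - corner"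
  by (auto simp: Z_def)

lemma openin_Z_carrier: "openin Y (topspace Y - corner)"
  by (simp add: closedin_corner openin_diff)

lemma density:
  assumes "continuous_map Y euclideanreal \<Psi>" "closed T" "\<And>x. x \<in> topspace plank \<Longrightarrow> \<Psi> (e x) \<in> T" "y \<in> topspace Y"
  shows "\<Psi> y \<in> T"
proof (rule closure_of_value[OF assms(1,2)])
  show "y \<in> Y closure_of (e ` topspace plank)" using assms(4) by (simp only: dense)
qed (use assms(3) in blast)

text \<open>A function that is 0 near the corner and 1 off the core separates \<open>e x\<close>
  from the corner.\<close>

lemma e_in_Z:
  assumes "x \<in> topspace plank"
  shows "e x \<in> topspace Z"
proof -
  obtain a b p where x: "x = ((a, b), p)" "(a, b) \<in> indices" "p \<in> ends"
    using assms by (auto simp: topspace_plank)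
  \<comment> \<open>Each of the two sets is empty or a singleton and not both are empty; together
    they put the index of \<open>x\<close> outside the core.\<close>
  define A where "A = {a'. a = Some a'}"
  define B where "B = {b'. b = Some b'}"
  have A: "countable A" unfolding A_def by (rule countable_subset[of _ "{the a}"]) auto
  have B: "small B" unfolding B_def by (rule small_subset[OF small_singleton[of "the b"]]) auto
  have i: "(a, b) \<in> indices - core A B"
    using x(2) by (cases a; cases b) (auto simp: core_def A_def B_def indices_def)
  have c: "continuous_map plank (top_of_set {0..1}) (\<lambda>_. 0 :: real)" by simp
  have z: "slow (\<lambda>_. 0)" "unit_seq (\<lambda>_. 0)" by (auto simp: slow_def unit_seq_def)
  obtain k where k: "continuous_map plank (top_of_set {0..1}) k"
    "\<And>i p. i \<in> core A B \<Longrightarrow> p \<in> ends \<Longrightarrow> k (i, p) = p (\<lambda>_. 0)"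
    "\<And>i. i \<in> indices - core A B \<Longrightarrow> \<exists>\<phi>. unit_seq \<phi> \<and> (\<forall>p\<in>ends. 0 = p \<phi> \<and> k (i, p) = p ((\<lambda>_. 1) \<circ> \<phi>))"
    by (rule continuous_map_plank_piecewise[OF c A B z, of "\<lambda>_. 1"]) auto
  obtain F where F: "continuous_map Y (top_of_set {0..1}) F" "\<And>x. x \<in> topspace plank \<Longrightarrow> F (e x) = k x"
    using extension[OF k(1)] by blast
  have "F y \<in> {0}" if "y \<in> corner" for y
  proof (rule corner_value[OF to_real[OF F(1)] _ A B _ that])
    fix i p assume "i \<in> core A B" "p \<in> ends"
    then show "F (e (i, p)) \<in> {0}"
      using F(2)[of "(i, p)"] k(2)[of i p] core_subset[of A B] ends_value_limit[OF z(2) tendsto_const]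
      by (auto simp: topspace_plank)
  qed simp
  moreover have "F (e x) = 1"
  proof -
    have "unit_seq (\<lambda>_. 1)" by (simp add: unit_seq_def)
    then have "p (\<lambda>_. 1) = 1" using ends_value_limit[OF _ tendsto_const x(3)] by blast
    then show ?thesis using F(2)[OF assms] k(3)[OF i] x by (auto simp: o_def)
  qed
  moreover have "e x \<in> topspace Y" using e_in_Y x by simp
  ultimately show ?thesis by (force simp: topspace_Z)
qed

lemma dense_Z: "Y closure_of (topspace Y - corner) = topspace Y"
proof -
  have "e ` topspace plank \<subseteq> topspace Y - corner" using e_in_Z by (auto simp: topspace_Z)
  from closure_of_mono[OF this, of Y] have "topspace Y \<subseteq> Y closure_of (topspace Y - corner)"
    by (simp only: dense)
  then show ?thesis by (intro subset_antisym closure_of_subset_topspace)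
qed

lemma density_Z:
  assumes "continuous_map Z euclideanreal \<Psi>" "closed T" "\<And>x. x \<in> topspace plank \<Longrightarrow> \<Psi> (e x) \<in> T" "y \<in> topspace Z"
  shows "\<Psi> y \<in> T"
proof (rule closure_of_value[OF assms(1,2)])
  have "(topspace Y - corner) \<inter> e ` topspace plank = e ` topspace plank"
    using e_in_Z by (auto simp: topspace_Z)
  then show "y \<in> Z closure_of (e ` topspace plank)"
    using assms(4) by (simp add: Z_def closure_of_subtopology dense)
qed (use assms(3) in auto)

lemma continuous_map_e_Z: "continuous_map plank Z e"
proof -
  have "e \<in> topspace plank \<rightarrow> topspace Y - corner" using e_in_Z unfolding topspace_Z by blast
  with continuous show ?thesis unfolding Z_def continuous_map_in_subtopology by blast
qed

lemma from_Y: "continuous_map Y X F \<Longrightarrow> continuous_map Z X F"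
  unfolding Z_def by (rule continuous_map_from_subtopology)

text \<open>Pull \<open>f\<close> back to the plank, extend to \<open>Y\<close>, and compare on
  \<open>Z\<close> by density. This makes \<open>Y\<close> the Cech-Stone compactification of
  \<open>Z\<close>.\<close>

lemma extension_from_Z:
  assumes f: "continuous_map Z (top_of_set {0..1}) f"
  shows "\<exists>F. continuous_map Y (top_of_set {0..1::real}) F \<and> (\<forall>x\<in>topspace Z. F x = f x)"
proof -
  obtain F where F: "continuous_map Y (top_of_set {0..1::real}) F" "\<And>x. x \<in> topspace plank \<Longrightarrow> F (e x) = f (e x)"
    using extension[OF continuous_map_compose[OF continuous_map_e_Z f]] by auto
  have "F z - f z \<in> {0}" if "z \<in> topspace Z" for z
  proof (rule density_Z[OF _ _ _ that])
    show "continuous_map Z euclideanreal (\<lambda>z. F z - f z)"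
      using from_Y[OF to_real[OF F(1)]] f
      by (intro continuous_map_diff) (auto simp: continuous_map_in_subtopology)
  qed (simp_all add: F(2))
  with F(1) show ?thesis by (intro exI[of _ F]) auto
qed

text \<open>A Urysohn function at \<open>z\<close> is thresholded termwise at 1/2 off the core; it
  vanishes on the core, where 0 can be prescribed, so a continuous function with values 0 and 1
  results.\<close>

lemma clopen_base_Z:
  assumes z: "z \<in> topspace Z" and W: "openin Y W" "z \<in> W"
  obtains C where "openin Y C" "closedin Y C" "z \<in> C" "C \<subseteq> W - corner"
proof -
  obtain A B where AB: "countable A" "small B" "z \<notin> core_closure A B"
    using z by (auto simp: topspace_Z corner_def)
  let ?Q = "core_closure A B \<union> (topspace Y - W)"
  have zY: "z \<in> topspace Y" using z by (simp add: topspace_Z)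
  have "closedin Y ?Q" using W(1) by (intro closedin_Un) (auto simp: core_closure_def)
  moreover have "closedin Y {z}" using zY by (intro closedin_Hausdorff_singleton Hausdorff)
  moreover have "?Q \<inter> {z} = {}" using AB(3) W(2) by auto
  ultimately obtain F :: "'y \<Rightarrow> real" where F: "continuous_map Y (top_of_set {0..1}) F"
    "\<And>y. y \<in> ?Q \<Longrightarrow> F y = 0" "F z = 1"
    using Urysohn by (metis singletonI)
  define \<theta> :: "real \<Rightarrow> real" where "\<theta> t = of_bool (t > 1/2)" for t
  have z0: "slow (\<lambda>_. 0)" "unit_seq (\<lambda>_. 0)" by (auto simp: slow_def unit_seq_def)
  obtain k where k: "continuous_map plank (top_of_set {0..1}) k"
    "\<And>i p. i \<in> core A B \<Longrightarrow> p \<in> ends \<Longrightarrow> k (i, p) = p (\<lambda>_. 0)"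
    "\<And>i. i \<in> indices - core A B \<Longrightarrow>
      \<exists>\<phi>. unit_seq \<phi> \<and> (\<forall>p\<in>ends. (F \<circ> e) (i, p) = p \<phi> \<and> k (i, p) = p (\<theta> \<circ> \<phi>))"
    by (rule continuous_map_plank_piecewise[OF continuous_map_compose[OF continuous F(1)] AB(1,2) z0, of \<theta>])
       (auto simp: \<theta>_def)
  obtain \<kappa> where \<kappa>: "continuous_map Y (top_of_set {0..1}) \<kappa>" "\<And>x. x \<in> topspace plank \<Longrightarrow> \<kappa> (e x) = k x"
    using extension[OF k(1)] by blast
  \<comment> \<open>Vanishing of \<open>R\<close> combines three conditions: \<open>t\<close> is 0
    or 1, \<open>t = 1\<close> if \<open>s > 1/2\<close>, and \<open>t = 0\<close> if
    \<open>s < 1/2\<close>. Being one continuous equation, it passes from the plank to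
    \<open>Y\<close> by density; at \<open>s = 1/2\<close> the choice is left open.\<close>
  define R :: "real \<Rightarrow> real \<Rightarrow> real" where
    "R s t = \<bar>t * (1 - t)\<bar> + max 0 (s - 1/2) * \<bar>1 - t\<bar> + max 0 (1/2 - s) * \<bar>t\<bar>" for s t
  have R: "R (F y) (\<kappa> y) \<in> {0}" if "y \<in> topspace Y" for y
  proof (rule density[OF _ _ _ that])
    show "continuous_map Y euclideanreal (\<lambda>y. R (F y) (\<kappa> y))"
      unfolding R_def using to_real[OF F(1)] to_real[OF \<kappa>(1)]
      by (intro continuous_map_add continuous_map_real_mult continuous_map_real_max
          continuous_map_diff continuous_map_real_abs) auto
    fix x assume x: "x \<in> topspace plank"
    obtain i p where ip: "x = (i, p)" "i \<in> indices" "p \<in> ends" using x by (auto simp: topspace_plank)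
    show "R (F (e x)) (\<kappa> (e x)) \<in> {0}"
    proof (cases "i \<in> core A B")
      case True
      have "e x \<in> core_closure A B"
        unfolding core_closure_def using True ip e_in_Y core_subset[of A B]
        by (intro subsetD[OF closure_of_subset]) auto
      then have "F (e x) = 0" using F(2) by blast
      moreover have "\<kappa> (e x) = 0"
        using \<kappa>(2)[OF x] k(2)[OF True ip(3)] ends_value_limit[OF z0(2) tendsto_const ip(3)] ip by simp
      ultimately show ?thesis by (simp add: R_def)
    next
      case False
      then obtain \<phi> where \<phi>: "unit_seq \<phi>" "F (e x) = p \<phi>" "k x = p (\<theta> \<circ> \<phi>)"
        using k(3)[of i] ip by auto
      have u: "unit_seq (\<theta> \<circ> \<phi>)" by (simp add: unit_seq_def \<theta>_def)
      have "R (p \<phi>) (p (\<theta> \<circ> \<phi>)) = 0"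
      proof (rule ends_value_identity[OF _ _ ip(3)])
        show "continuous_map bw euclideanreal (\<lambda>p. R (p \<phi>) (p (\<theta> \<circ> \<phi>)))"
          unfolding R_def
          by (intro continuous_map_add continuous_map_real_mult continuous_map_real_max
              continuous_map_diff continuous_map_real_abs continuous_map_value \<phi> u) auto
        show "R (pt n \<phi>) (pt n (\<theta> \<circ> \<phi>)) = 0" for n
          unfolding pt_apply[OF \<phi>(1)] pt_apply[OF u] by (simp add: R_def \<theta>_def)
      qed
      then show ?thesis using \<phi> \<kappa>(2)[OF x] by simp
    qed
  qed simp
  have R3: "t * (1 - t) = 0" "s > 1/2 \<longrightarrow> t = 1" "s < 1/2 \<longrightarrow> t = 0" if "R s t = 0" for s t
  proof -
    have "\<bar>t * (1 - t)\<bar> \<ge> 0" "max 0 (s - 1/2) * \<bar>1 - t\<bar> \<ge> 0" "max 0 (1/2 - s) * \<bar>t\<bar> \<ge> 0" by auto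
    then have "\<bar>t * (1 - t)\<bar> = 0" "max 0 (s - 1/2) * \<bar>1 - t\<bar> = 0" "max 0 (1/2 - s) * \<bar>t\<bar> = 0"
      using that unfolding R_def by linarith+
    then show "t * (1 - t) = 0" "s > 1/2 \<longrightarrow> t = 1" "s < 1/2 \<longrightarrow> t = 0" by auto
  qed
  let ?C = "{y \<in> topspace Y. \<kappa> y \<in> {1}}"
  have two: "\<kappa> y = 0 \<or> \<kappa> y = 1" if "y \<in> topspace Y" for y
    using R3(1) R[OF that] by auto
  have C_eq: "?C = {y \<in> topspace Y. \<kappa> y \<in> {1/2<..}}" using two by force
  show thesis
  proof
    show "openin Y ?C"
      unfolding C_eq by (rule openin_continuous_map_preimage[OF to_real[OF \<kappa>(1)]]) simp
    show "closedin Y ?C"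
      by (rule closedin_continuous_map_preimage[OF to_real[OF \<kappa>(1)]]) simp
    show "z \<in> ?C" using R3(2)[of "F z" "\<kappa> z"] R[OF zY] F(3) zY by simp
    have "y \<notin> ?Q" if "y \<in> ?C" for y
      using R3(3)[of "F y" "\<kappa> y"] R[of y] F(2)[of y] that by auto
    then show "?C \<subseteq> W - corner" using corner_subset[OF AB(1,2)] by blast
  qed
qed

lemma tychonoff_Z: "tychonoff_space Z"
proof -
  have "normal_space Y"
    using compact Hausdorff by (intro compact_Hausdorff_or_regular_imp_normal_space) auto
  then have "completely_regular_space Y"
    using Hausdorff by (intro normal_imp_completely_regular_space) auto
  then show ?thesis
    unfolding tychonoff_space_def Z_def
    using Hausdorff completely_regular_space_subtopology Hausdorff_space_subtopology by blast
qed

lemma zero_dimensional_Z: "zero_dimensional Z"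
  unfolding zero_dimensional_def
proof
  show "t1_space Z" using tychonoff_Z Hausdorff_imp_t1_space by (auto simp: tychonoff_space_def)
  show "openin Z = arbitrary union_of (\<lambda>U. openin Z U \<and> closedin Z U)"
  proof (rule ext, rule iffI)
    fix V assume V: "openin Z V"
    then have VY: "openin Y V" "V \<subseteq> topspace Z"
      using openin_open_subtopology[OF openin_Z_carrier] openin_subset by (auto simp: Z_def topspace_Z)
    show "(arbitrary union_of (\<lambda>U. openin Z U \<and> closedin Z U)) V"
      unfolding arbitrary_union_of_alt
    proof
      fix z assume z: "z \<in> V"
      then obtain C where C: "openin Y C" "closedin Y C" "z \<in> C" "C \<subseteq> V - corner"
        using clopen_base_Z[OF _ VY(1), of z] VY(2) by blast
      have "C \<subseteq> topspace Y - corner" using C(2,4) closedin_subset by blast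
      then have "openin Z C" "closedin Z C"
        unfolding Z_def using C(1,2)
        by (metis inf.absorb1 openin_subtopology_Int, metis inf.absorb1 closedin_subtopology_Int_closed inf_commute)
      then show "\<exists>U. (openin Z U \<and> closedin Z U) \<and> z \<in> U \<and> U \<subseteq> V" using C by blast
    qed
  next
    fix V assume "(arbitrary union_of (\<lambda>U. openin Z U \<and> closedin Z U)) V"
    then show "openin Z V" unfolding union_of_def arbitrary_def by auto
  qed
qed

text \<open>Here 1/2 plays the part of zero. Off the core the termwise sign works; on the core it
  need not be slow, and the softened sign \<open>h\<close> fulfils the equation modulo c_0, which is
  enough at the ends.\<close>

lemma sign_extension:
  assumes f: "continuous_map Z (top_of_set {0..1}) f"
  obtains \<kappa> where "continuous_map Z euclideanreal \<kappa>"
    "\<And>z. z \<in> topspace Z \<Longrightarrow> 2 * f z - 1 = (2 * \<kappa> z - 1) * \<bar>2 * f z - 1\<bar>"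
proof -
  have fe: "continuous_map plank (top_of_set {0..1}) (f \<circ> e)"
    by (rule continuous_map_compose[OF continuous_map_e_Z f])
  obtain g A B where g: "slow g" "unit_seq g" "countable A" "small B"
    "\<And>i p. i \<in> core A B \<Longrightarrow> p \<in> ends \<Longrightarrow> (f \<circ> e) (i, p) = p g"
    using continuous_map_plank_core[OF fe] by metis
  obtain h where h: "slow h" "unit_seq h" "(\<lambda>n. (2 * g n - 1) - (2 * h n - 1) * \<bar>2 * g n - 1\<bar>) \<longlonglongrightarrow> 0"
    using slow_sign_unit[OF g(1,2)] by blast
  define \<theta> :: "real \<Rightarrow> real" where "\<theta> t = of_bool (t > 1/2)" for t
  obtain k where k: "continuous_map plank (top_of_set {0..1}) k"
    "\<And>i p. i \<in> core A B \<Longrightarrow> p \<in> ends \<Longrightarrow> k (i, p) = p h"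
    "\<And>i. i \<in> indices - core A B \<Longrightarrow>
      \<exists>\<phi>. unit_seq \<phi> \<and> (\<forall>p\<in>ends. (f \<circ> e) (i, p) = p \<phi> \<and> k (i, p) = p (\<theta> \<circ> \<phi>))"
    by (rule continuous_map_plank_piecewise[OF fe g(3,4) h(1,2), of \<theta>]) (auto simp: \<theta>_def)
  obtain \<kappa> where \<kappa>: "continuous_map Y (top_of_set {0..1}) \<kappa>" "\<And>x. x \<in> topspace plank \<Longrightarrow> \<kappa> (e x) = k x"
    using extension[OF k(1)] by blast
  define R :: "real \<Rightarrow> real \<Rightarrow> real" where "R s t = (2 * s - 1) - (2 * t - 1) * \<bar>2 * s - 1\<bar>" for s t
  have \<kappa>Z: "continuous_map Z euclideanreal \<kappa>" by (rule from_Y[OF to_real[OF \<kappa>(1)]])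
  have "R (f z) (\<kappa> z) \<in> {0}" if "z \<in> topspace Z" for z
  proof (rule density_Z[OF _ _ _ that])
    show "continuous_map Z euclideanreal (\<lambda>z. R (f z) (\<kappa> z))"
      unfolding R_def using f \<kappa>Z
      by (intro continuous_map_real_mult continuous_map_diff continuous_map_real_abs)
         (auto simp: continuous_map_in_subtopology)
    fix x assume x: "x \<in> topspace plank"
    obtain i p where ip: "x = (i, p)" "i \<in> indices" "p \<in> ends" using x by (auto simp: topspace_plank)
    have R_value: "continuous_map bw euclideanreal (\<lambda>p. R (p \<phi>) (p \<psi>))" if "unit_seq \<phi>" "unit_seq \<psi>" for \<phi> \<psi>
      unfolding R_def
      by (intro continuous_map_real_mult continuous_map_diff continuous_map_real_abs
          continuous_map_value that) auto
    show "R (f (e x)) (\<kappa> (e x)) \<in> {0}"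
    proof (cases "i \<in> core A B")
      case True
      have "R (p g) (p h) = 0"
        by (rule ends_limit[OF R_value[OF g(2) h(2)] _ ip(3)])
           (unfold pt_apply[OF g(2)] pt_apply[OF h(2)] R_def, rule h(3))
      then show ?thesis using g(5)[OF True ip(3)] k(2)[OF True ip(3)] \<kappa>(2)[OF x] ip by simp
    next
      case False
      then obtain \<phi> where \<phi>: "unit_seq \<phi>" "f (e x) = p \<phi>" "k x = p (\<theta> \<circ> \<phi>)"
        using k(3)[of i] ip by auto
      have u: "unit_seq (\<theta> \<circ> \<phi>)" by (simp add: unit_seq_def \<theta>_def)
      have "R (p \<phi>) (p (\<theta> \<circ> \<phi>)) = 0"
      proof (rule ends_value_identity[OF R_value[OF \<phi>(1) u] _ ip(3)])
        show "R (pt n \<phi>) (pt n (\<theta> \<circ> \<phi>)) = 0" for n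
          unfolding pt_apply[OF \<phi>(1)] pt_apply[OF u] by (simp add: R_def \<theta>_def)
      qed
      then show ?thesis using \<phi> \<kappa>(2)[OF x] by simp
    qed
  qed simp
  then show thesis using that[OF \<kappa>Z] by (simp add: R_def)
qed

lemma F_space_Z: "F_space Z"
  unfolding F_space_def
proof (intro conjI tychonoff_Z allI impI)
  fix f assume f: "continuous_map Z euclideanreal f"
  \<comment> \<open>Bounds \<open>f\<close> without changing its sign: \<open>2 * b t - 1\<close> is
    \<open>t\<close> divided by \<open>1 + \<bar>t\<bar>\<close>, so the sign found for it also
    serves \<open>f\<close>.\<close>
  define b where "b t = (t / (1 + \<bar>t\<bar>) + 1) / 2" for t :: real
  have b: "b t \<in> {0..1}" for t
  proof -
    have d: "1 + \<bar>t\<bar> > 0" by (rule add_pos_nonneg) auto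
    have "\<bar>t / (1 + \<bar>t\<bar>)\<bar> = \<bar>t\<bar> / (1 + \<bar>t\<bar>)" by (rule abs_div_pos[OF d, symmetric])
    also have "\<dots> \<le> 1" unfolding divide_le_eq_1_pos[OF d] by simp
    finally show ?thesis
      unfolding b_def abs_le_iff atLeastAtMost_iff by argo
  qed
  have "continuous_on UNIV b"
    unfolding b_def by (intro continuous_intros) (auto simp: add_nonneg_eq_0_iff)
  then have "continuous_map euclideanreal euclideanreal b" by simp
  from continuous_map_compose[OF f this] have "continuous_map Z (top_of_set {0..1}) (b \<circ> f)"
    using b unfolding continuous_map_in_subtopology comp_apply by blast
  then obtain \<kappa> where \<kappa>: "continuous_map Z euclideanreal \<kappa>"
    "\<And>z. z \<in> topspace Z \<Longrightarrow> 2 * (b \<circ> f) z - 1 = (2 * \<kappa> z - 1) * \<bar>2 * (b \<circ> f) z - 1\<bar>"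
    using sign_extension by metis
  show "\<exists>k. continuous_map Z euclideanreal k \<and> (\<forall>z\<in>topspace Z. f z = k z * \<bar>f z\<bar>)"
  proof (intro exI[of _ "\<lambda>z. 2 * \<kappa> z - 1"] conjI ballI)
    show "continuous_map Z euclideanreal (\<lambda>z. 2 * \<kappa> z - 1)"
      using \<kappa>(1) by (intro continuous_map_diff continuous_map_real_mult) auto
    fix z assume z: "z \<in> topspace Z"
    let ?d = "1 + \<bar>f z\<bar>"
    have d: "?d > 0" by (rule add_pos_nonneg) auto
    have "2 * (b \<circ> f) z - 1 = f z / ?d" unfolding b_def comp_apply by argo
    then have "f z / ?d = (2 * \<kappa> z - 1) * (\<bar>f z\<bar> / ?d)"
      using \<kappa>(2)[OF z] unfolding abs_div_pos[OF d] by metis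
    moreover have "x = c * y" if "x / d = c * (y / d)" "d > 0" for x y c d :: real
      using that by simp
    ultimately show "f z = (2 * \<kappa> z - 1) * \<bar>f z\<bar>" using d by blast
  qed
qed

section \<open>The remainder of \<open>Z\<close>\<close>

lemma Cech_Stone_Z:
  "\<exists>H. homeomorphic_map Y (Cech_Stone Z) H \<and> (\<forall>z\<in>topspace Z. H z = evaluation Z z)"
  using Cech_Stone_homeomorphic_map[OF compact Hausdorff Diff_subset dense_Z, folded Z_def, folded topspace_Z,
      OF extension_from_Z] .

lemma homeomorphic_remainder:
  assumes H: "homeomorphic_map Y (Cech_Stone Z) H" and ev: "\<And>z. z \<in> topspace Z \<Longrightarrow> H z = evaluation Z z"
  shows "homeomorphic_map (subtopology Y corner) (Cech_Stone_remainder Z) H"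
  unfolding Cech_Stone_remainder_def
proof (rule homeomorphic_map_subtopologies[OF H])
  have inj: "inj_on H (topspace Y)" and sur: "H ` topspace Y = topspace (Cech_Stone Z)"
    using H homeomorphic_imp_injective_map homeomorphic_imp_surjective_map by blast+
  have "evaluation Z ` topspace Z = H ` (topspace Y - corner)"
    using ev unfolding topspace_Z by (intro image_cong) auto
  then have image: "topspace (Cech_Stone Z) - evaluation Z ` topspace Z = H ` corner"
    using inj corner_subset_Y unfolding sur[symmetric]
    by (simp add: inj_on_image_set_diff[of H "topspace Y", symmetric] double_diff)
  have corner: "topspace Y \<inter> corner = corner" using corner_subset_Y by blast
  have "topspace (Cech_Stone Z) \<inter> (topspace (Cech_Stone Z) - E) = topspace (Cech_Stone Z) - E" for E
    by blast
  from trans[OF image[symmetric] this[symmetric]]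
  show "H ` (topspace Y \<inter> corner) =
      topspace (Cech_Stone Z) \<inter> (topspace (Cech_Stone Z) - evaluation Z ` topspace Z)"
    unfolding corner .
qed

text \<open>Clopen sets cannot separate two points of the connected image of the corner.\<close>

lemma not_strongly_zero_dimensional_Z: "\<not> strongly_zero_dimensional Z"
proof
  assume "strongly_zero_dimensional Z"
  then have zd: "zero_dimensional (Cech_Stone Z)" by (simp add: strongly_zero_dimensional_def)
  obtain H where H: "homeomorphic_map Y (Cech_Stone Z) H" using Cech_Stone_Z by blast
  obtain y z where yz: "y \<in> corner" "z \<in> corner" "y \<noteq> z" using corner_nontrivial by blast
  have "connectedin Y corner"
    using continuum_corner corner_subset_Y by (simp add: continuum_def connectedin_def)
  then have conn: "connectedin (Cech_Stone Z) (H ` corner)"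
    using connectedin_continuous_map_image homeomorphic_imp_continuous_map[OF H] by blast
  have inj: "inj_on H (topspace Y)" and sur: "H ` topspace Y = topspace (Cech_Stone Z)"
    using H homeomorphic_imp_injective_map homeomorphic_imp_surjective_map by blast+
  have ne: "H y \<noteq> H z" and mem: "H y \<in> topspace (Cech_Stone Z)" "H z \<in> topspace (Cech_Stone Z)"
    using inj_onD[OF inj] yz corner_subset_Y sur by blast+
  have "openin (Cech_Stone Z) (topspace (Cech_Stone Z) - {H z})"
    using mem(2) by (intro openin_diff openin_topspace closedin_Hausdorff_singleton Hausdorff_space_Cech_Stone)
  then have "(arbitrary union_of (\<lambda>U. openin (Cech_Stone Z) U \<and> closedin (Cech_Stone Z) U))
      (topspace (Cech_Stone Z) - {H z})"
    using zd unfolding zero_dimensional_def by metis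
  then have "\<forall>x\<in>topspace (Cech_Stone Z) - {H z}.
      \<exists>C. (openin (Cech_Stone Z) C \<and> closedin (Cech_Stone Z) C) \<and> x \<in> C \<and> C \<subseteq> topspace (Cech_Stone Z) - {H z}"
    unfolding arbitrary_union_of_alt .
  moreover have "H y \<in> topspace (Cech_Stone Z) - {H z}" using mem(1) ne by simp
  ultimately obtain C where C: "openin (Cech_Stone Z) C" "closedin (Cech_Stone Z) C" "H y \<in> C"
    "C \<subseteq> topspace (Cech_Stone Z) - {H z}" by meson
  then have "H ` corner \<subseteq> C \<or> disjnt (H ` corner) C"
    using connectedin_clopen_cases[OF conn] by blast
  then show False using C(3,4) yz(1,2) unfolding disjnt_def by blast
qed

lemma indecomposable_remainder_Z: "indecomposable_continuum (Cech_Stone_remainder Z)"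
proof -
  from Cech_Stone_Z obtain H where H: "homeomorphic_map Y (Cech_Stone Z) H"
    and ev: "\<forall>z\<in>topspace Z. H z = evaluation Z z" by (elim exE conjE)
  have "homeomorphic_map (subtopology Y corner) (Cech_Stone_remainder Z) H"
    by (rule homeomorphic_remainder[OF H]) (use ev in simp)
  then have "subtopology Y corner homeomorphic_space Cech_Stone_remainder Z"
    by (rule homeomorphic_map_imp_homeomorphic_space)
  then show ?thesis by (rule homeomorphic_indecomposable_continuum[OF _ indecomposable_corner])
qed

end

theorem mainTheorem3:
  shows "\<exists>Z :: real set set set topology.
    tychonoff_space Z \<and> zero_dimensional Z \<and> F_space Z \<and> \<not> strongly_zero_dimensional Z \<and>
    indecomposable_continuum (Cech_Stone_remainder Z)"
proof -
  obtain Y :: "real set set set topology" and e where "plank_compactification Y e"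
    using plank_compactification_exists by blast
  then interpret plank_compactification Y e .
  show ?thesis
    using tychonoff_Z zero_dimensional_Z F_space_Z not_strongly_zero_dimensional_Z
      indecomposable_remainder_Z by blast
qed

end
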